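(* Let $\mathcal{H}$ be a real Hilbert space, let $m\ge1$ be an integer, and let $U_1,\ldots,U_{2m}$ be closed affine subspaces of $\mathcal{H}$ with $\bigcap_{i=1}^{2m}U_i\ne\varnothing$. Set $\mathrm{I}:=\{1,\ldots,m\}$ and assume that $\operatorname{par}U_{2i-1}+\operatorname{par}U_{2i}$ is closed for every $i\in\mathrm{I}$. For $i\in\mathrm{I}$ set $$\mathcal{S}_i:=\{\mathrm{Id},\,\mathrm{R}_{U_{2i-1}},\,\mathrm{R}_{U_{2i}},\,\mathrm{R}_{U_{2i}}\mathrm{R}_{U_{2i-1}}\}.$$ Let $G:\mathcal{H}\to\mathcal{H}$ be such that one of the following holds: (i) for every $i\in\mathrm{I}$ the sum $\sum_{j=1}^{2i}(\operatorname{par}U_j)^\perp$ is closed, and $G=CC_{\mathcal{S}_m}\circ CC_{\mathcal{S}_{m-1}}\circ\cdots\circ CC_{\mathcal{S}_1}$; (ii) $\sum_{j=1}^{2m}(\operatorname{par}U_j)^\perp$ is closed, and $G=\sum_{i=1}^m\omega_iCC_{\mathcal{S}_i}$, where $\{\omega_i\}_{1\le i\le m}\subseteq\,]0,1]$ and $\sum_{i=1}^m\omega_i=1$. Then $\operatorname{Fix}G=\bigcap_{i=1}^{2m}U_i$ and $G$ is a BAM. Moreover, there exists $\gamma\in[0,1[$ such that $$(\forall x\in\mathcal{H})(\forall k\in\mathbb{N})\quad\big\|G^kx-\mathrm{P}_{\bigcap_{i=1}^{2m}U_i}x\big\|\le\gamma^k\big\|x-\mathrm{P}_{\bigcap_{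i=1}^{2m}U_i}x\big\|.$$
   Context: For a nonempty closed convex set $C\subseteq\mathcal{H}$, $\mathrm{P}_C$ denotes the metric projection onto $C$ and $\mathrm{R}_C:=2\mathrm{P}_C-\mathrm{Id}$ the reflector. $\operatorname{Fix}G=\{x\in\mathcal{H}: Gx=x\}$. For an affine subspace $U$ (nonempty by convention), $\operatorname{par}U=U-u$ (any $u\in U$) is the linear subspace parallel to $U$. $\mathbb{N}=\{0,1,2,\ldots\}$. Products of operators denote composition. Definition (BAM). Let $G:\mathcal{H}\to\mathcal{H}$ and $\gamma\in[0,1[$. $G$ is a best approximation mapping with constant $\gamma$ ($\gamma$-BAM) if (1) $\operatorname{Fix}G$ is a nonempty closed convex subset of $\mathcal{H}$; (2) $\mathrm{P}_{\operatorname{Fix}G}G=\mathrm{P}_{\operatorname{Fix}G}$; (3) $\|Gx-\mathrm{P}_{\operatorname{Fix}G}x\|\le\gamma\|x-\mathrm{P}_{\operatorname{Fix}G}x\|$ for all $x\in\mathcal{H}$. $G$ is a BAM if it is a $\gamma$-BAM for some $\gamma\in[0,1[$. Circumcenter mapping: for a finite set $\mathcal{S}$ of affine isometries of $\mathcal{H}$ having a common fixed point (e.g. compositions of reflectors in closed affine subspaces with a common point), and $x\in\mathcal{H}$, $CC_{\mathcal{S}}x$ is the unique point $p$ in the affine hull of $\mathcal{S}(x)=\{Tx:T\in\mathcal{S}\}$ such that $\{\|p-Tx\|:T\in\mathcal{S}\}$ is a singleton. It is a known fact that such a point exists and is unique for every $x$, so $CC_{\mathcal{S}}:\mathcal{H}\to\mathcal{H}$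 is well defined. *)

theory Defs
  imports "HOL-Analysis.Analysis"
begin

text \<open>
  A real Hilbert space is a type of sort \<open>{real_inner, complete_space}\<close>. The library's
  \<open>closest_point\<close> is restricted to \<open>heine_borel\<close> types, hence to finite dimension, so the
  metric projection is defined here.
\<close>

definition proj :: "'a::real_inner set \<Rightarrow> 'a \<Rightarrow> 'a"
  where "proj C x = (THE p. p \<in> C \<and> (\<forall>y\<in>C. norm (x - p) \<le> norm (x - y)))"

definition reflector :: "'a::real_inner set \<Rightarrow> 'a \<Rightarrow> 'a"
  where "reflector C x = 2 *\<^sub>R proj C x - x"

definition Fix :: "('a \<Rightarrow> 'a) \<Rightarrow> 'a set"
  where "Fix G = {x. G x = x}"

text \<open>
  The translate does not depend on the chosen base point if \<open>U\<close> is affine; see \<open>par_eq\<close>.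
\<close>

definition par :: "'a::real_vector set \<Rightarrow> 'a set"
  where "par U = (\<lambda>x. x - (SOME u. u \<in> U)) ` U"

lemma par_eq:
  assumes "affine U" "u \<in> U"
  shows "par U = (\<lambda>x. x - u) ` U"
proof -
  have *: "(\<lambda>x. x - v) ` U \<subseteq> (\<lambda>x. x - w) ` U" if "v \<in> U" "w \<in> U" for v w
  proof clarify
    fix x assume "x \<in> U"
    have "1 *\<^sub>R x + (-1) *\<^sub>R v + 1 *\<^sub>R w \<in> U"
      using mem_affine_3[OF assms(1) \<open>x \<in> U\<close> that, of 1 "-1" 1] by simp
    then have "x - v + w \<in> U" by simp
    then show "x - v \<in> (\<lambda>x. x - w) ` U" by (auto intro!: image_eqI[of _ _ "x - v + w"])
  qed
  have "(SOME u. u \<in> U) \<in> U" using assms(2) by (rule someI)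
  with assms(2) show ?thesis unfolding par_def by (intro equalityI *)
qed

definition is_gamma_BAM :: "real \<Rightarrow> ('a::real_inner \<Rightarrow> 'a) \<Rightarrow> bool"
  where "is_gamma_BAM \<gamma> G \<longleftrightarrow>
    0 \<le> \<gamma> \<and> \<gamma> < 1 \<and>
    Fix G \<noteq> {} \<and> closed (Fix G) \<and> convex (Fix G) \<and>
    proj (Fix G) \<circ> G = proj (Fix G) \<and>
    (\<forall>x. norm (G x - proj (Fix G) x) \<le> \<gamma> * norm (x - proj (Fix G) x))"

definition is_BAM :: "('a::real_inner \<Rightarrow> 'a) \<Rightarrow> bool"
  where "is_BAM G \<longleftrightarrow> (\<exists>\<gamma>. is_gamma_BAM \<gamma> G)"

text \<open>
  The circumcenter exists and is unique if \<open>S\<close> is a nonempty finite set of affine isometries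
  with a common fixed point; for other \<open>S\<close> the value may be unspecified.
\<close>

definition CC :: "('a::real_inner \<Rightarrow> 'a) set \<Rightarrow> 'a \<Rightarrow> 'a"
  where "CC S x = (THE p. p \<in> affine hull ((\<lambda>T. T x) ` S) \<and>
                          is_singleton ((\<lambda>T. norm (p - T x)) ` S))"

end

theory Submission
  imports Defs
begin

text \<open>
  The circumcenter of the four points is the point of their affine hull closest to
  \<open>P\<^sub>M x\<close>, where \<open>M\<close> is the intersection of the two subspaces \<open>A\<close> and \<open>B\<close>, because
  all four points have the same distance from \<open>P\<^sub>M x\<close>. As \<open>P\<^sub>B P\<^sub>A x\<close> is the mean of the four
  points, \<open>CC\<close> contracts towards \<open>M\<close> at least as well as alternating projections do.

  All contraction factors come from linear regularity, i.e. a bound of the distance to an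
  intersection by a multiple of the sum of the distances to its members. The closedness
  assumptions yield it by the open mapping theorem. A \<open>\<gamma>\<close>-BAM with fixed point set \<open>C\<close> decreases
  the squared distance to every point of \<open>C\<close> by at least \<open>1 - \<gamma>\<^sup>2\<close> times the squared distance to
  \<open>C\<close>. Under linear regularity these decreases add up to a fixed fraction of the squared distance
  to the intersection, for compositions as well as for convex combinations.
\<close>

subsection \<open>Projections onto closed affine subspaces\<close>

text \<open>A minimizing sequence in \<open>C\<close> is Cauchy by the parallelogram law, and
  closedness puts its limit into \<open>C\<close>.\<close>

lemma nearest_point_exists:
  fixes C :: "'a::{real_inner, complete_space} set"
  assumes "convex C" "closed C" "C \<noteq> {}"
  shows "\<exists>p\<in>C. \<forall>y\<in>C. norm (x - p) \<le> norm (x - y)"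
proof -
  define d where "d = (INF y\<in>C. norm (x - y))"
  have bdd: "bdd_below ((\<lambda>y. norm (x - y)) ` C)"
    by (rule bdd_belowI2[where m = 0]) simp
  have d_le: "d \<le> norm (x - y)" if "y \<in> C" for y
    unfolding d_def using bdd that by (rule cINF_lower)
  have d0: "0 \<le> d"
    unfolding d_def using assms(3) by (intro cINF_greatest) auto
  \<comment> \<open>The error is measured on squared distances, since the parallelogram law is
    quadratic.\<close>
  have "\<exists>y\<in>C. (norm (x - y))\<^sup>2 < d\<^sup>2 + 1 / real (Suc n)" for n
  proof -
    have "d < sqrt (d\<^sup>2 + 1 / real (Suc n))"
      by (rule real_less_rsqrt) simp
    then obtain y where y: "y \<in> C" "norm (x - y) < sqrt (d\<^sup>2 + 1 / real (Suc n))"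
      unfolding d_def using cINF_less_iff[OF assms(3) bdd] by blast
    then have "(norm (x - y))\<^sup>2 < (sqrt (d\<^sup>2 + 1 / real (Suc n)))\<^sup>2"
      by (intro power_strict_mono) auto
    then show ?thesis using y(1) by auto
  qed
  then obtain y where yC: "\<And>n. y n \<in> C"
    and y: "\<And>n. (norm (x - y n))\<^sup>2 < d\<^sup>2 + 1 / real (Suc n)"
    by metis
  \<comment> \<open>Parallelogram law: the midpoint of \<open>y k\<close> and \<open>y n\<close>
    lies in \<open>C\<close>, so its squared distance to \<open>x\<close> is at least that of
    \<open>d\<close>.\<close>
  have par: "(norm (y k - y n))\<^sup>2 \<le> 2 / real (Suc k) + 2 / real (Suc n)" for k n
  proof -
    have "(1/2) *\<^sub>R y k + (1/2) *\<^sub>R y n \<in> C"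
      using assms(1) yC by (intro convexD) auto
    then have "d\<^sup>2 \<le> (norm (x - ((1/2) *\<^sub>R y k + (1/2) *\<^sub>R y n)))\<^sup>2"
      using d_le d0 by (intro power_mono) auto
    moreover have "(norm (y k - y n))\<^sup>2 = 2 * (norm (x - y k))\<^sup>2 + 2 * (norm (x - y n))\<^sup>2
        - 4 * (norm (x - ((1/2) *\<^sub>R y k + (1/2) *\<^sub>R y n)))\<^sup>2"
      unfolding power2_norm_eq_inner
      by (simp add: inner_diff_left inner_diff_right inner_add_left inner_add_right
          inner_commute algebra_simps)
    ultimately show ?thesis
      using y[of k] y[of n] by simp
  qed
  have "Cauchy y"
  proof (rule metric_CauchyI)
    fix e :: real assume e: "0 < e"
    obtain N :: nat where N: "4 / e\<^sup>2 < real N" using reals_Archimedean2 by blast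
    have N0: "0 < real N" using N e by (meson divide_nonneg_nonneg le_less_trans zero_le_numeral zero_le_power2)
    have *: "1 / real (Suc n) \<le> 1 / real N" if "N \<le> n" for n
      using that N0 by (intro divide_left_mono) auto
    have "dist (y k) (y n) < e" if "N \<le> k" "N \<le> n" for k n
    proof -
      have "(norm (y k - y n))\<^sup>2 \<le> 4 / real N"
        using par[of k n] *[OF that(1)] *[OF that(2)] by simp
      also have "\<dots> < e\<^sup>2" using N N0 e by (simp add: field_simps)
      finally show ?thesis
        using e by (simp add: dist_norm power_less_imp_less_base)
    qed
    then show "\<exists>M. \<forall>k\<ge>M. \<forall>n\<ge>M. dist (y k) (y n) < e" by blast
  qed
  then obtain p where p: "y \<longlonglongrightarrow> p"
    using Cauchy_convergent convergent_def by blast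
  have "p \<in> C" using assms(2) yC p by (rule closed_sequentially)
  moreover have "(norm (x - p))\<^sup>2 \<le> d\<^sup>2"
  proof (rule LIMSEQ_le)
    show "(\<lambda>n. (norm (x - y n))\<^sup>2) \<longlonglongrightarrow> (norm (x - p))\<^sup>2" by (intro tendsto_intros p)
    show "(\<lambda>n. d\<^sup>2 + 1 / real (Suc n)) \<longlonglongrightarrow> d\<^sup>2"
      using tendsto_add[OF tendsto_const LIMSEQ_inverse_real_of_nat, of "d\<^sup>2"]
      by (simp add: inverse_eq_divide)
    show "\<exists>N. \<forall>n\<ge>N. (norm (x - y n))\<^sup>2 \<le> d\<^sup>2 + 1 / real (Suc n)" using y less_imp_le by blast
  qed
  then have "norm (x - p) \<le> d" using d0 by (rule power2_le_imp_le)
  ultimately show ?thesis using d_le order_trans by blast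
qed

lemma affine_in_line:
  assumes "affine C" "y \<in> C" "y' \<in> C" "p \<in> C"
  shows "p + t *\<^sub>R (y - y') \<in> C"
  using mem_affine_3[OF assms(1,4,2,3), of 1 t "- t"] by (simp add: algebra_simps)

text \<open>Moving from \<open>p\<close> by \<open>t *\<^sub>R (y - p)\<close> changes the squared
  distance to \<open>x\<close> by \<open>t\<^sup>2 * b - 2 * t * a\<close>. At the minimizer
  \<open>t = a / b\<close> this is negative unless \<open>a = 0\<close>.\<close>

lemma nearest_point_orthogonal:
  assumes "affine C" "p \<in> C" "\<forall>y\<in>C. norm (x - p) \<le> norm (x - y)" "y \<in> C"
  shows "(x - p) \<bullet> (y - p) = 0"
proof (rule ccontr)
  define a b where "a = (x - p) \<bullet> (y - p)" and "b = (norm (y - p))\<^sup>2"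
  assume "(x - p) \<bullet> (y - p) \<noteq> 0"
  then have a: "a \<noteq> 0" and b: "0 < b" by (auto simp: a_def b_def)
  define t where "t = a / b"
  have "norm (x - p) \<le> norm (x - (p + t *\<^sub>R (y - p)))"
    using assms affine_in_line by blast
  then have "(norm (x - p))\<^sup>2 \<le> (norm ((x - p) - t *\<^sub>R (y - p)))\<^sup>2"
    by (simp add: power_mono diff_diff_eq)
  also have "\<dots> = (norm (x - p))\<^sup>2 - 2 * t * a + t\<^sup>2 * b"
    unfolding power2_norm_eq_inner a_def b_def
    by (simp add: inner_diff_left[of _ _ "_ - _"] inner_diff_right[of "_ - _"] inner_commute
        power2_eq_square power2_norm_eq_inner inner_diff_left inner_diff_right algebra_simps)
  finally have "2 * t * a \<le> t\<^sup>2 * b" by simp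
  then have "2 * a\<^sup>2 / b \<le> a\<^sup>2 / b" using b by (simp add: t_def power2_eq_square)
  then have "a\<^sup>2 \<le> 0" using b by (simp add: field_simps)
  then show False using a by simp
qed

lemma pythagoras:
  assumes "u \<bullet> v = 0" shows "(norm (u + v))\<^sup>2 = (norm u)\<^sup>2 + (norm v)\<^sup>2"
  using assms by (simp add: power2_norm_eq_inner inner_add_left inner_add_right inner_commute)

text \<open>By Pythagoras, such a \<open>p\<close> is the only minimizer, which resolves the
  definite description in \<open>proj\<close>. Values of \<open>proj\<close> are computed below by
  this orthogonality criterion.\<close>

lemma proj_eqI:
  assumes "p \<in> C" and orth: "\<And>y. y \<in> C \<Longrightarrow> (x - p) \<bullet> (y - p) = 0"
  shows "proj C x = p"
proof -
  have *: "(norm (x - y))\<^sup>2 = (norm (x - p))\<^sup>2 + (norm (p - y))\<^sup>2" if "y \<in> C" for y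
    using pythagoras[of "x - p" "p - y"] orth[OF that]
    by (simp add: inner_diff_right)
  show ?thesis
    unfolding proj_def
  proof (rule the_equality, safe)
    show "p \<in> C" by fact
  next
    fix y assume "y \<in> C"
    then show "norm (x - p) \<le> norm (x - y)"
      using * by (intro power2_le_imp_le[OF _ norm_ge_zero]) auto
  next
    fix q assume q: "q \<in> C" "\<forall>y\<in>C. norm (x - q) \<le> norm (x - y)"
    then have "(norm (x - q))\<^sup>2 \<le> (norm (x - p))\<^sup>2" using assms(1) by (simp add: power_mono)
    then show "q = p" using *[OF q(1)] by simp
  qed
qed

locale closed_affine =
  fixes C :: "'a::{real_inner, complete_space} set"
  assumes affine: "affine C" and closed: "closed C" and nonempty: "C \<noteq> {}"
begin

lemma proj_props: "proj C x \<in> C \<and> (\<forall>y\<in>C. (x - proj C x) \<bullet> (y - proj C x) = 0)"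
proof -
  obtain p where p: "p \<in> C" "\<forall>y\<in>C. norm (x - p) \<le> norm (x - y)"
    using nearest_point_exists affine_imp_convex affine closed nonempty by metis
  then have "\<forall>y\<in>C. (x - p) \<bullet> (y - p) = 0"
    using nearest_point_orthogonal affine by blast
  with p(1) show ?thesis using proj_eqI by metis
qed

lemma proj_in [simp]: "proj C x \<in> C"
  using proj_props by blast

lemma proj_orth:
  assumes "y \<in> C" "y' \<in> C" shows "(x - proj C x) \<bullet> (y - y') = 0"
proof -
  have "(x - proj C x) \<bullet> (y - proj C x) = 0" "(x - proj C x) \<bullet> (y' - proj C x) = 0"
    using proj_props assms by blast+
  then show ?thesis by (simp add: inner_diff_right)
qed

lemma proj_id [simp]: "x \<in> C \<Longrightarrow> proj C x = x"
  by (rule proj_eqI) auto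

lemma norm_proj_pythagoras:
  assumes "y \<in> C" "proj C z = proj C x"
  shows "(norm (z - y))\<^sup>2 = (norm (z - proj C x))\<^sup>2 + (norm (proj C x - y))\<^sup>2"
  using pythagoras[of "z - proj C x" "proj C x - y"] proj_orth[of "proj C x" y z] assms by simp

lemma norm_proj_le: "y \<in> C \<Longrightarrow> norm (x - proj C x) \<le> norm (x - y)"
  using norm_proj_pythagoras[of y x x] by (intro power2_le_imp_le[OF _ norm_ge_zero]) auto

text \<open>Turns equality of projections into a linear condition on \<open>z - x\<close>, which
  adds up along compositions and convex combinations. This is how
  \<open>proj C (T x) = proj C x\<close> is propagated.\<close>

lemma proj_eq_iff:
  "proj C z = proj C x \<longleftrightarrow> (\<forall>y\<in>C. \<forall>y'\<in>C. (z - x) \<bullet> (y - y') = 0)"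
proof
  assume eq: "proj C z = proj C x"
  show "\<forall>y\<in>C. \<forall>y'\<in>C. (z - x) \<bullet> (y - y') = 0"
  proof safe
    fix y y' assume "y \<in> C" "y' \<in> C"
    from proj_orth[OF this, of z] proj_orth[OF this, of x] eq
    show "(z - x) \<bullet> (y - y') = 0" by (simp add: inner_diff_left)
  qed
next
  assume *: "\<forall>y\<in>C. \<forall>y'\<in>C. (z - x) \<bullet> (y - y') = 0"
  show "proj C z = proj C x"
  proof (rule proj_eqI)
    fix y assume "y \<in> C"
    then have "(z - x) \<bullet> (y - proj C x) = 0" "(x - proj C x) \<bullet> (y - proj C x) = 0"
      using * proj_orth by auto
    then show "(z - proj C x) \<bullet> (y - proj C x) = 0" by (simp add: inner_diff_left)
  qed simp
qed

text \<open>The instance of affinity of \<open>proj C\<close> that later writes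
  \<open>proj B (proj A x)\<close> as the mean of the four reflected points.\<close>

lemma proj_midpoint:
  "proj C ((1/2) *\<^sub>R (x + y)) = (1/2) *\<^sub>R (proj C x + proj C y)"
proof (rule proj_eqI)
  let ?m = "(1/2) *\<^sub>R (proj C x + proj C y)"
  show m: "?m \<in> C"
    using convexD[OF affine_imp_convex[OF affine] proj_in proj_in, of "1/2" "1/2" x y]
    by (simp add: scaleR_add_right)
  fix c assume c: "c \<in> C"
  have "(1/2) *\<^sub>R (x + y) - ?m = (1/2) *\<^sub>R ((x - proj C x) + (y - proj C y))"
    by (simp add: algebra_simps)
  then show "((1/2) *\<^sub>R (x + y) - ?m) \<bullet> (c - ?m) = 0"
    by (simp only: inner_scaleR_left inner_add_left proj_orth[OF c m]) simp
qed

end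

lemma closed_affine_Inter:
  assumes "\<And>j. j \<in> J \<Longrightarrow> closed_affine (U j)" "(\<Inter>j\<in>J. U j) \<noteq> {}"
  shows "closed_affine (\<Inter>j\<in>J. U j)"
  using assms by (auto simp: closed_affine_def intro!: affine_Inter)

lemma closed_affine_Int:
  assumes "closed_affine A" "closed_affine B" "A \<inter> B \<noteq> {}"
  shows "closed_affine (A \<inter> B)"
  using assms by (auto simp: closed_affine_def intro: affine_Int)

subsection \<open>The open mapping theorem for closed sums of subspaces\<close>

lemma subspace_set_sum:
  fixes N :: "'i \<Rightarrow> 'a::real_vector set"
  assumes "finite J" "\<And>j. j \<in> J \<Longrightarrow> subspace (N j)"
  shows "subspace (\<Sum>j\<in>J. N j)"
  using assms
proof (induction J)
  case (insert j J)
  then have "subspace {x + y | x y. x \<in> N j \<and> y \<in> sum N J}" by (intro subspace_sums) auto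
  also have "{x + y | x y. x \<in> N j \<and> y \<in> sum N J} = sum N (insert j J)"
    using insert.hyps by (auto simp: set_plus_def)
  finally show ?case .
qed (simp add: set_zero)

text \<open>First half of the open mapping theorem for the addition map from the product of the
  \<open>N j\<close> onto their sum. The sum is complete because it is closed, so Baire's theorem
  applies; it yields approximate preimages of controlled size with relative error one half.\<close>

lemma closed_sum_almost_open:
  fixes N :: "'i \<Rightarrow> 'a::{real_normed_vector, complete_space} set"
  assumes fin: "finite J" and sub: "\<And>j. j \<in> J \<Longrightarrow> subspace (N j)"
    and clo: "closed (\<Sum>j\<in>J. N j)"
  shows "\<exists>K\<ge>0. \<forall>v\<in>(\<Sum>j\<in>J. N j). \<exists>y. (\<forall>j\<in>J. y j \<in> N j \<and> norm (y j) \<le> K * norm v) \<and>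
           norm (v - (\<Sum>j\<in>J. y j)) \<le> norm v / 2"
proof -
  define V where "V = (\<Sum>j\<in>J. N j)"
  have V_eq: "V = {sum y J | y. \<forall>j\<in>J. y j \<in> N j}"
    unfolding V_def using fin by (rule set_sum_alt)
  \<comment> \<open>\<open>B n\<close> is the image under addition of the product of the balls of
    radius \<open>n\<close> in the \<open>N j\<close>.\<close>
  define B where "B n = {sum y J | y. \<forall>j\<in>J. y j \<in> N j \<and> norm (y j) \<le> real n}" for n :: nat
  have "subspace V"
    unfolding V_def using fin sub by (rule subspace_set_sum)
  note V0 = subspace_0[OF this] and V_add = subspace_add[OF this] and V_scale = subspace_scale[OF this]
  have BV: "closure (B n) \<subseteq> V" for n
    using clo unfolding V_def[symmetric]
    by (intro closure_minimal) (auto simp: B_def V_eq)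
  have cover: "V = (\<Union>n. closure (B n))"
  proof
    show "V \<subseteq> (\<Union>n. closure (B n))"
    proof
      fix v assume "v \<in> V"
      then obtain y where y: "v = sum y J" "\<forall>j\<in>J. y j \<in> N j" unfolding V_eq by blast
      obtain n :: nat where n: "(\<Sum>j\<in>J. norm (y j)) \<le> real n" using real_arch_simple by blast
      have "norm (y j) \<le> real n" if "j \<in> J" for j
        using n member_le_sum[OF that, of "\<lambda>j. norm (y j)"] fin by auto
      then have "v \<in> B n" unfolding B_def using y by blast
      then show "v \<in> (\<Union>n. closure (B n))" using closure_subset by blast
    qed
  qed (use BV in blast)
  \<comment> \<open>If every \<open>closure (B n)\<close> had empty interior relative to
    \<open>V\<close>, so would their union \<open>V\<close>, although
    \<open>0 \<in> V\<close>.\<close>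
  have "\<exists>n. (top_of_set V) interior_of closure (B n) \<noteq> {}"
  proof (rule ccontr)
    assume no: "\<not> ?thesis"
    have "(top_of_set V) interior_of \<Union>(range (\<lambda>n. closure (B n))) = {}"
    proof (rule Baire_category_alt)
      have "completely_metrizable_space (top_of_set V)"
        using completely_metrizable_space_closedin[OF completely_metrizable_space_euclidean] clo
        unfolding V_def by simp
      then show "completely_metrizable_space (top_of_set V) \<or>
        locally_compact_space (top_of_set V) \<and> regular_space (top_of_set V)" ..
      show "closedin (top_of_set V) T \<and> (top_of_set V) interior_of T = {}"
        if "T \<in> range (\<lambda>n. closure (B n))" for T
        using that no closed_subset[OF BV closed_closure] by auto
    qed auto
    moreover have "(top_of_set V) interior_of V = V"
      by (metis interior_of_topspace topspace_euclidean_subtopology)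
    ultimately show False using V0 cover by auto
  qed
  \<comment> \<open>By Baire some closure of \<open>B n\<close> contains a relative ball; subtracting its centre moves the ball to \<open>0\<close>.\<close>
  then obtain n v0 T where "openin (top_of_set V) T" "v0 \<in> T" "T \<subseteq> closure (B n)"
    unfolding interior_of_def by blast
  then obtain r where r: "0 < r" and ball: "ball v0 r \<inter> V \<subseteq> closure (B n)" and v0: "v0 \<in> V"
    unfolding openin_contains_ball by blast
  have small: "\<exists>y. (\<forall>j\<in>J. y j \<in> N j \<and> norm (y j) \<le> 2 * real n) \<and> norm (w - sum y J) < e"
    if w: "w \<in> V" "norm w < r" and e: "0 < e" for w e
  proof -
    have "v0 \<in> closure (B n)" "v0 + w \<in> closure (B n)"
      using ball w v0 r V_add by (auto simp: dist_norm)
    then obtain b b' where "b \<in> B n" "b' \<in> B n" and d: "dist b v0 < e/2" "dist b' (v0 + w) < e/2"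
      using e unfolding closure_approachable by (meson half_gt_zero)
    then obtain y y' where y: "b = sum y J" "\<forall>j\<in>J. y j \<in> N j \<and> norm (y j) \<le> real n"
      "b' = sum y' J" "\<forall>j\<in>J. y' j \<in> N j \<and> norm (y' j) \<le> real n"
      unfolding B_def by blast
    have "norm (w - (b' - b)) \<le> norm (v0 + w - b') + norm (b - v0)"
      by (rule order_trans[OF _ norm_triangle_ineq]) (simp add: algebra_simps)
    also have "\<dots> < e" using d by (simp add: dist_norm norm_minus_commute)
    finally have "norm (w - sum (\<lambda>j. y' j - y j) J) < e" using y by (simp add: sum_subtractf)
    moreover have "y' j - y j \<in> N j \<and> norm (y' j - y j) \<le> 2 * real n" if "j \<in> J" for j
    proof
      show "y' j - y j \<in> N j" using y that sub[OF that] by (intro subspace_diff) auto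
      show "norm (y' j - y j) \<le> 2 * real n"
        using norm_triangle_ineq4[of "y' j" "y j"] y that by fastforce
    qed
    ultimately show ?thesis by (intro exI[of _ "\<lambda>j. y' j - y j"]) simp
  qed
  have "\<exists>y. (\<forall>j\<in>J. y j \<in> N j \<and> norm (y j) \<le> (4 * real n / r) * norm v) \<and>
      norm (v - sum y J) \<le> norm v / 2" if v: "v \<in> V" for v
  proof (cases "v = 0")
    case True
    then show ?thesis using sub by (intro exI[of _ "\<lambda>_. 0"]) (simp add: subspace_0)
  next
    case False
    \<comment> \<open>Scales \<open>v\<close> to norm \<open>r / 2\<close>, inside the ball. The
      tolerance \<open>r / 4\<close> becomes \<open>norm v / 2\<close> after scaling back, and the
      bound \<open>2 * real n\<close> becomes \<open>(4 * real n / r) * norm v\<close>.\<close>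
    define c where "c = r / (2 * norm v)"
    have c: "0 < c" using r False by (simp add: c_def)
    have nc: "norm (c *\<^sub>R v) = r / 2" using r False by (simp add: c_def)
    then obtain y where y: "\<forall>j\<in>J. y j \<in> N j \<and> norm (y j) \<le> 2 * real n"
      and d: "norm (c *\<^sub>R v - sum y J) < r / 4"
      using small[OF V_scale[OF v], of c "r/4"] r by auto
    have "v - sum (\<lambda>j. (1/c) *\<^sub>R y j) J = (1/c) *\<^sub>R (c *\<^sub>R v - sum y J)"
      using c by (simp add: scaleR_right_diff_distrib scaleR_sum_right)
    then have "norm (v - sum (\<lambda>j. (1/c) *\<^sub>R y j) J) = norm (c *\<^sub>R v - sum y J) / c"
      using c by simp
    also have "\<dots> \<le> (r / 4) / c" using d c by (intro divide_right_mono) auto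
    also have "\<dots> = norm v / 2" using r False by (simp add: c_def)
    finally have "norm (v - sum (\<lambda>j. (1/c) *\<^sub>R y j) J) \<le> norm v / 2" .
    moreover have "norm ((1/c) *\<^sub>R y j) \<le> (4 * real n / r) * norm v" if "j \<in> J" for j
    proof -
      have "norm ((1/c) *\<^sub>R y j) = norm (y j) / c" using c by simp
      also have "\<dots> \<le> (2 * real n) / c" using y that c by (intro divide_right_mono) auto
      finally show ?thesis using r by (simp add: c_def)
    qed
    moreover have "(1/c) *\<^sub>R y j \<in> N j" if "j \<in> J" for j
      using y that sub subspace_scale by blast
    ultimately show ?thesis by (intro exI[of _ "\<lambda>j. (1/c) *\<^sub>R y j"]) simp
  qed
  moreover have "0 \<le> 4 * real n / r" using r by simp
  ultimately show ?thesis unfolding V_def by blast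
qed

text \<open>The library results on dominated series need the class \<open>banach\<close>, which is not implied by
  the sort \<open>{real_normed_vector, complete_space}\<close>.\<close>

lemma dominated_series:
  fixes f :: "nat \<Rightarrow> 'a::{real_normed_vector, complete_space}"
  assumes le: "\<And>k. norm (f k) \<le> g k" and g: "summable g"
  shows "summable f" "norm (suminf f) \<le> suminf g"
proof -
  define s where "s n = (\<Sum>k<n. f k)" for n
  define t where "t n = (\<Sum>k<n. g k)" for n
  have diff: "norm (s m - s n) \<le> \<bar>t m - t n\<bar>" if "n \<le> m" for m n
  proof -
    have "s m - s n = sum f {n..<m}" "t m - t n = sum g {n..<m}"
      unfolding s_def t_def lessThan_atLeast0 using that by (simp_all add: sum_diff_nat_ivl)
    then show ?thesis using sum_norm_le[of "{n..<m}" f g] le by simp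
  qed
  have dist: "dist (s m) (s n) \<le> dist (t m) (t n)" for m n
    using diff[of m n] diff[of n m]
    by (cases "n \<le> m") (auto simp: dist_norm norm_minus_commute abs_minus_commute)
  have "Cauchy t"
    using summable_LIMSEQ[OF g] unfolding t_def by (rule LIMSEQ_imp_Cauchy)
  then have "Cauchy s"
    unfolding Cauchy_def using dist by (meson le_less_trans)
  then have "convergent s" by (rule Cauchy_convergent)
  then show f: "summable f" unfolding s_def by (simp add: summable_iff_convergent)
  have "(\<lambda>n. norm (s n)) \<longlonglongrightarrow> norm (suminf f)"
    using summable_LIMSEQ[OF f] unfolding s_def by (rule tendsto_norm)
  moreover have "norm (s n) \<le> t n" for n
    using diff[of 0 n] sum_nonneg[of "{..<n}" g] le order_trans[OF norm_ge_zero le]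
    by (simp add: s_def t_def)
  ultimately show "norm (suminf f) \<le> suminf g"
    using summable_LIMSEQ[OF g] unfolding t_def by (blast intro: LIMSEQ_le)
qed

text \<open>Second half of the open mapping theorem: the approximation is applied again to each
  remainder. The remainders at least halve, so the corrections form geometrically dominated series,
  whose limits stay in the closed \<open>N j\<close>.\<close>

lemma closed_sum_bounded_decomposition:
  fixes N :: "'i \<Rightarrow> 'a::{real_normed_vector, complete_space} set"
  assumes fin: "finite J" and sub: "\<And>j. j \<in> J \<Longrightarrow> subspace (N j)"
    and cloN: "\<And>j. j \<in> J \<Longrightarrow> closed (N j)"
    and clo: "closed (\<Sum>j\<in>J. N j)"
  shows "\<exists>K\<ge>0. \<forall>v\<in>(\<Sum>j\<in>J. N j). \<exists>y. (\<forall>j\<in>J. y j \<in> N j \<and> norm (y j) \<le> K * norm v) \<and>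
           v = (\<Sum>j\<in>J. y j)"
proof -
  define V where "V = (\<Sum>j\<in>J. N j)"
  have V_eq: "V = {sum y J | y. \<forall>j\<in>J. y j \<in> N j}"
    unfolding V_def using fin by (rule set_sum_alt)
  obtain K where K: "0 \<le> K" and "\<forall>v\<in>V. \<exists>y. (\<forall>j\<in>J. y j \<in> N j \<and> norm (y j) \<le> K * norm v) \<and>
           norm (v - sum y J) \<le> norm v / 2"
    using closed_sum_almost_open[OF fin sub clo] unfolding V_def by blast
  then obtain Y where Y: "\<And>v j. v \<in> V \<Longrightarrow> j \<in> J \<Longrightarrow> Y v j \<in> N j"
    and YK: "\<And>v j. v \<in> V \<Longrightarrow> j \<in> J \<Longrightarrow> norm (Y v j) \<le> K * norm v"
    and Yd: "\<And>v. v \<in> V \<Longrightarrow> norm (v - sum (Y v) J) \<le> norm v / 2"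
    by metis
  have "subspace V"
    unfolding V_def using fin sub by (rule subspace_set_sum)
  then have step: "v - sum (Y v) J \<in> V" if v: "v \<in> V" for v
    using Y[OF v] v by (intro subspace_diff) (auto simp: V_eq)
  have "\<exists>y. (\<forall>j\<in>J. y j \<in> N j \<and> norm (y j) \<le> (2 * K) * norm v) \<and> v = sum y J"
    if v: "v \<in> V" for v
  proof -
    \<comment> \<open>\<open>w k\<close> is the remainder of \<open>v\<close> after \<open>k\<close>
      corrections.\<close>
    define w where "w = rec_nat v (\<lambda>_ u. u - sum (Y u) J)"
    have w0: "w 0 = v" and wS: "w (Suc k) = w k - sum (Y (w k)) J" for k
      by (simp_all add: w_def)
    have wV: "w k \<in> V" for k
      by (induction k) (simp_all add: w0 wS v step)
    have wn: "norm (w k) \<le> norm v * (1/2)^k" for k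
    proof (induction k)
      case (Suc k)
      show ?case using Yd[OF wV[of k]] Suc by (simp add: wS)
    qed (simp add: w0)
    have sums: "(\<lambda>k. K * norm v * (1/2)^k) sums (K * norm v * 2)"
      using sums_mult[OF geometric_sums[of "1/2::real"], of "K * norm v"] by simp
    have Yb: "norm (Y (w k) j) \<le> K * norm v * (1/2)^k" if "j \<in> J" for k j
      using YK[OF wV that, of k] mult_left_mono[OF wn K, of k] by (simp add: mult.assoc)
    have summ: "summable (\<lambda>k. Y (w k) j)" if "j \<in> J" for j
      using Yb[OF that] sums_summable[OF sums] by (rule dominated_series(1))
    define y where "y j = (\<Sum>k. Y (w k) j)" for j
    have lim: "(\<lambda>n. \<Sum>k<n. Y (w k) j) \<longlonglongrightarrow> y j" if "j \<in> J" for j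
      using summ[OF that] unfolding y_def by (rule summable_LIMSEQ)
    have "y j \<in> N j" if j: "j \<in> J" for j
    proof (rule closed_sequentially[OF cloN[OF j] _ lim[OF j]])
      show "(\<Sum>k<n. Y (w k) j) \<in> N j" for n
        using sub[OF j] Y[OF wV j] by (intro subspace_sum) auto
    qed
    moreover have "norm (y j) \<le> (2 * K) * norm v" if j: "j \<in> J" for j
    proof -
      have "norm (y j) \<le> (\<Sum>k. K * norm v * (1/2)^k)"
        unfolding y_def using Yb[OF j] sums_summable[OF sums]
        by (rule dominated_series(2))
      then show ?thesis using sums_unique[OF sums] by simp
    qed
    moreover have "v = sum y J"
    proof -
      \<comment> \<open>Telescoping: the remainder after \<open>n\<close> steps is \<open>v\<close>
        minus all corrections made so far.\<close>
      have "v - w n = (\<Sum>j\<in>J. \<Sum>k<n. Y (w k) j)" for n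
        by (induction n) (simp_all add: w0 wS sum.distrib algebra_simps)
      moreover have "(\<lambda>n. \<Sum>j\<in>J. \<Sum>k<n. Y (w k) j) \<longlonglongrightarrow> sum y J"
        using lim by (intro tendsto_sum)
      moreover have "(\<lambda>n. v - w n) \<longlonglongrightarrow> v - 0"
      proof (intro tendsto_intros)
        have "(\<lambda>n. norm v * (1/2)^n) \<longlonglongrightarrow> norm v * 0"
          by (intro tendsto_intros LIMSEQ_power_zero) simp
        then show "w \<longlonglongrightarrow> 0"
          using wn by (intro Lim_null_comparison[of w "\<lambda>n. norm v * (1/2)^n"]) auto
      qed
      ultimately show ?thesis using LIMSEQ_unique by fastforce
    qed
    ultimately show ?thesis by blast
  qed
  then show ?thesis using K unfolding V_def by (intro exI[of _ "2 * K"]) auto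
qed

subsection \<open>Linear regularity\<close>

text \<open>Distances to the sets are written with \<open>proj\<close>, and one constant serves the
  whole space, not only bounded subsets.\<close>

definition linearly_regular :: "'i set \<Rightarrow> ('i \<Rightarrow> 'a::real_inner set) \<Rightarrow> bool"
  where "linearly_regular J U \<longleftrightarrow> (\<exists>\<kappa>\<ge>0. \<forall>x.
    norm (x - proj (\<Inter>j\<in>J. U j) x) \<le> \<kappa> * (\<Sum>j\<in>J. norm (x - proj (U j) x)))"

lemma closed_orthogonal_comp: "closed (orthogonal_comp W)"
proof -
  have "orthogonal_comp W = (\<Inter>y\<in>W. {x. y \<bullet> x = 0})"
    by (auto simp: orthogonal_comp_def orthogonal_def)
  also have "closed \<dots>"
    by (intro closed_INT ballI closed_Collect_eq continuous_intros)
  finally show ?thesis .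
qed

text \<open>Removes the chosen base point of \<open>par\<close> and gives orthogonality in the form
  in which \<open>proj_orth\<close> delivers it.\<close>

lemma mem_orthogonal_comp_par:
  assumes "affine C"
  shows "v \<in> orthogonal_comp (par C) \<longleftrightarrow> (\<forall>y\<in>C. \<forall>y'\<in>C. v \<bullet> (y - y') = 0)"
proof (cases "C = {}")
  case True
  then show ?thesis by (simp add: par_def orthogonal_comp_def)
next
  case False
  show ?thesis
  proof
    assume v: "v \<in> orthogonal_comp (par C)"
    show "\<forall>y\<in>C. \<forall>y'\<in>C. v \<bullet> (y - y') = 0"
    proof (intro ballI)
      fix y y' assume "y \<in> C" "y' \<in> C"
      then have "y - y' \<in> par C" using par_eq[OF assms] by blast
      then show "v \<bullet> (y - y') = 0"
        using v by (auto simp: orthogonal_comp_def orthogonal_def inner_commute)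
    qed
  next
    assume *: "\<forall>y\<in>C. \<forall>y'\<in>C. v \<bullet> (y - y') = 0"
    obtain u where "u \<in> C" using False by blast
    then show "v \<in> orthogonal_comp (par C)"
      using * by (auto simp: par_eq[OF assms] orthogonal_comp_def orthogonal_def inner_commute)
  qed
qed

text \<open>The component \<open>v\<close> of \<open>x - z\<close> in the sum \<open>V\<close> of
  the normal spaces leads from the intersection to \<open>x\<close>. A bounded decomposition of
  \<open>v\<close> into normals \<open>y j\<close> bounds \<open>v \<bullet> v\<close>, since each
  \<open>y j\<close> sees only the displacement of \<open>x\<close> from \<open>U j\<close>.\<close>

lemma linearly_regular_if_closed_sum_orthogonal_comp:
  fixes U :: "'i \<Rightarrow> 'a::{real_inner, complete_space} set"
  assumes fin: "finite J" and U: "\<And>j. j \<in> J \<Longrightarrow> closed_affine (U j)"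
    and ne: "(\<Inter>j\<in>J. U j) \<noteq> {}"
    and clo: "closed (\<Sum>j\<in>J. orthogonal_comp (par (U j)))"
  shows "linearly_regular J U"
proof -
  let ?N = "\<lambda>j. orthogonal_comp (par (U j))"
  define V where "V = (\<Sum>j\<in>J. ?N j)"
  interpret C: closed_affine "\<Inter>j\<in>J. U j" using U ne by (rule closed_affine_Inter)
  obtain z where z: "\<And>j. j \<in> J \<Longrightarrow> z \<in> U j" using ne by blast
  have subV: "subspace V"
    unfolding V_def using fin subspace_orthogonal_comp by (rule subspace_set_sum)
  have NV: "u \<in> V" if "j \<in> J" "u \<in> ?N j" for u j
  proof -
    have "u = (\<Sum>k\<in>J. if k = j then u else 0)" using fin that by simp
    moreover have "\<forall>k\<in>J. (if k = j then u else 0) \<in> ?N k"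
      using that subspace_0[OF subspace_orthogonal_comp] by auto
    ultimately show ?thesis unfolding V_def set_sum_alt[OF fin] by blast
  qed
  interpret V: closed_affine V
    using clo subV subspace_imp_affine subspace_0 unfolding V_def[symmetric]
    by unfold_locales auto
  obtain K where K: "0 \<le> K" and dec: "\<And>v. v \<in> V \<Longrightarrow>
      \<exists>y. (\<forall>j\<in>J. y j \<in> ?N j \<and> norm (y j) \<le> K * norm v) \<and> v = (\<Sum>j\<in>J. y j)"
    using closed_sum_bounded_decomposition[OF fin subspace_orthogonal_comp closed_orthogonal_comp clo]
    unfolding V_def by blast
  have "norm (x - proj (\<Inter>j\<in>J. U j) x) \<le> K * (\<Sum>j\<in>J. norm (x - proj (U j) x))" for x
  proof -
    define v where "v = proj V (x - z)"
    define p where "p = x - v"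
    have vV: "v \<in> V" by (simp add: v_def)
    have orth: "(p - z) \<bullet> u = 0" if "u \<in> V" for u
      using V.proj_orth[OF that subspace_0[OF subV], of "x - z"] by (simp add: p_def v_def algebra_simps)
    \<comment> \<open>\<open>p - ?q\<close> is normal to \<open>U j\<close>, hence lies in
      \<open>V\<close> and is orthogonal to \<open>p - z\<close>; it is also orthogonal to
      \<open>?q - z\<close>. So it is orthogonal to itself.\<close>
    have pU: "p \<in> U j" if j: "j \<in> J" for j
    proof -
      interpret Uj: closed_affine "U j" using U[OF j] .
      let ?q = "proj (U j) p"
      have "p - ?q \<in> ?N j"
        using mem_orthogonal_comp_par[OF Uj.affine] Uj.proj_orth by blast
      then have "(p - z) \<bullet> (p - ?q) = 0" using orth NV[OF j] by blast
      moreover have "(p - ?q) \<bullet> (?q - z) = 0" using Uj.proj_orth[OF Uj.proj_in z[OF j]] .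
      ultimately have "(p - ?q) \<bullet> (p - ?q) = 0"
        by (simp add: inner_diff_left inner_diff_right inner_commute)
      then have "p = ?q" by simp
      then show ?thesis using Uj.proj_in by metis
    qed
    obtain y where y: "\<And>j. j \<in> J \<Longrightarrow> y j \<in> ?N j" "\<And>j. j \<in> J \<Longrightarrow> norm (y j) \<le> K * norm v"
      and v: "v = (\<Sum>j\<in>J. y j)" using dec[OF vV] by blast
    have "v \<bullet> v = (\<Sum>j\<in>J. y j \<bullet> v)" by (subst (1) v) (simp add: inner_sum_left)
    also have "\<dots> \<le> (\<Sum>j\<in>J. (K * norm v) * norm (x - proj (U j) x))"
    proof (rule sum_mono)
      fix j assume j: "j \<in> J"
      interpret Uj: closed_affine "U j" using U[OF j] .
      \<comment> \<open>Both points lie in \<open>U j\<close>, and \<open>y j\<close> is orthogonal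
        to its directions; so \<open>p\<close> may be replaced by \<open>proj (U j) x\<close> in
        \<open>v = x - p\<close>.\<close>
      have "y j \<bullet> (proj (U j) x - p) = 0"
        using y(1)[OF j] mem_orthogonal_comp_par[OF Uj.affine] pU[OF j] by auto
      then have "y j \<bullet> v = y j \<bullet> (x - proj (U j) x)"
        by (simp add: p_def inner_diff_right)
      also have "\<dots> \<le> norm (y j) * norm (x - proj (U j) x)" by (rule norm_cauchy_schwarz)
      also have "\<dots> \<le> (K * norm v) * norm (x - proj (U j) x)"
        using y(2)[OF j] by (intro mult_right_mono) auto
      finally show "y j \<bullet> v \<le> (K * norm v) * norm (x - proj (U j) x)" .
    qed
    finally have "norm v * norm v \<le> norm v * (K * (\<Sum>j\<in>J. norm (x - proj (U j) x)))"
      by (simp add: sum_distrib_left[symmetric] power2_norm_eq_inner[symmetric] power2_eq_square mult_ac)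
    then have "norm v \<le> K * (\<Sum>j\<in>J. norm (x - proj (U j) x))"
      using K by (cases "v = 0") (auto simp: sum_nonneg)
    moreover have "norm (x - proj (\<Inter>j\<in>J. U j) x) \<le> norm (x - p)"
      using pU by (intro C.norm_proj_le) blast
    ultimately show ?thesis by (simp add: p_def)
  qed
  then show ?thesis unfolding linearly_regular_def using K by blast
qed

text \<open>The difference of the projections of \<open>x\<close> lies in \<open>par (U a) + par (U b)\<close>; a bounded
  decomposition of it corrects the projection onto \<open>U a\<close> to a nearby point of the intersection.\<close>

lemma linearly_regular_pair_if_closed_sum_par:
  fixes U :: "'i \<Rightarrow> 'a::{real_inner, complete_space} set"
  assumes ab: "a \<noteq> b" and A: "closed_affine (U a)" and B: "closed_affine (U b)"
    and ne: "U a \<inter> U b \<noteq> {}" and clo: "closed (par (U a) + par (U b))"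
  shows "linearly_regular {a, b} U"
proof -
  interpret A: closed_affine "U a" by fact
  interpret B: closed_affine "U b" by fact
  interpret C: closed_affine "U a \<inter> U b" using A B ne by (rule closed_affine_Int)
  obtain z where z: "z \<in> U a" "z \<in> U b" using ne by blast
  have sub: "subspace (par (U j)) \<and> closed (par (U j))" if "closed_affine (U j)" "z \<in> U j" for j
  proof -
    have *: "par (U j) = (\<lambda>x. x - z) ` U j" using that by (intro par_eq) (auto simp: closed_affine_def)
    have "(\<lambda>x. x - z) ` U j = (\<lambda>x. - z + x) ` U j" by auto
    then show ?thesis unfolding * using that affine_diffs_subspace[of "U j" z] closed_translation[of "U j" "- z"]
      by (simp add: closed_affine_def)
  qed
  have par: "u \<in> par (U j) \<longleftrightarrow> z + u \<in> U j" if "closed_affine (U j)" "z \<in> U j" for j u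
    using that par_eq[of "U j" z] by (force simp: closed_affine_def)
  have sum: "(\<Sum>j\<in>{a, b}. par (U j)) = par (U a) + par (U b)" using ab by simp
  obtain K where K: "0 \<le> K" and dec: "\<And>v. v \<in> par (U a) + par (U b) \<Longrightarrow>
      \<exists>y. (\<forall>j\<in>{a, b}. y j \<in> par (U j) \<and> norm (y j) \<le> K * norm v) \<and> v = (\<Sum>j\<in>{a, b}. y j)"
    using closed_sum_bounded_decomposition[of "{a, b}" "\<lambda>j. par (U j)"] sub A B z clo
    unfolding sum by blast
  have "norm (x - proj (U a \<inter> U b) x) \<le> (K + 1) * (norm (x - proj (U a) x) + norm (x - proj (U b) x))" for x
  proof -
    let ?a = "proj (U a) x" and ?b = "proj (U b) x"
    have "?a - z \<in> par (U a)" "?b - z \<in> par (U b)" using par A B z by auto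
    then have "(?a - z) + (- (?b - z)) \<in> par (U a) + par (U b)"
      using sub[OF B z(2)] subspace_neg by blast
    then have "?a - ?b \<in> par (U a) + par (U b)" by simp
    from dec[OF this] ab obtain a' b' where
      a': "a' \<in> par (U a)" "norm a' \<le> K * norm (?a - ?b)" and b': "b' \<in> par (U b)"
      and eq: "?a - ?b = a' + b'" by auto
    have "z + ((?a - z) - a') \<in> U a"
      using par[OF A z(1)] \<open>?a - z \<in> _\<close> a' sub[OF A z(1)] subspace_diff by blast
    moreover have "z + ((?b - z) + b') \<in> U b"
      using par[OF B z(2)] \<open>?b - z \<in> _\<close> b' sub[OF B z(2)] subspace_add by blast
    \<comment> \<open>One point in two forms: the left one shows membership in \<open>U b\<close>,
      the right one in \<open>U a\<close>.\<close>
    moreover have "?b + b' = ?a - a'" using eq by (simp add: algebra_simps)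
    ultimately have "?a - a' \<in> U a \<inter> U b" by simp
    then have "norm (x - proj (U a \<inter> U b) x) \<le> norm (x - (?a - a'))" by (rule C.norm_proj_le)
    also have "\<dots> \<le> norm (x - ?a) + norm a'"
      using norm_triangle_ineq[of "x - ?a" a'] by (simp add: algebra_simps)
    also have "norm a' \<le> K * (norm (x - ?a) + norm (x - ?b))"
    proof -
      have "norm (?a - ?b) \<le> norm (x - ?a) + norm (x - ?b)"
        using norm_triangle_ineq4[of "x - ?b" "x - ?a"] by simp
      then show ?thesis using a'(2) K mult_left_mono order_trans by blast
    qed
    finally show ?thesis
      using norm_ge_zero[of "x - ?b"] unfolding distrib_left distrib_right by linarith
  qed
  then show ?thesis unfolding linearly_regular_def using K ab
    by (intro exI[of _ "K + 1"]) simp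
qed

subsection \<open>Best approximation mappings\<close>

text \<open>The fixed point set is a parameter here; \<open>bam_Fix\<close> recovers it from the inequality.\<close>

definition bam :: "real \<Rightarrow> 'a::real_inner set \<Rightarrow> ('a \<Rightarrow> 'a) \<Rightarrow> bool"
  where "bam \<gamma> C T \<longleftrightarrow> 0 \<le> \<gamma> \<and> \<gamma> < 1 \<and>
    (\<forall>x. proj C (T x) = proj C x \<and> norm (T x - proj C x) \<le> \<gamma> * norm (x - proj C x))"

context closed_affine
begin

lemma bam_proj: "bam 0 C (proj C)"
  by (simp add: bam_def)

lemma bam_Fix:
  assumes "bam \<gamma> C T" shows "Fix T = C"
proof (intro equalityI subsetI)
  fix x assume "x \<in> Fix T"
  then have "(1 - \<gamma>) * norm (x - proj C x) \<le> 0"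
    using assms unfolding bam_def Fix_def by (auto simp: algebra_simps dest: spec[of _ x])
  then have "x = proj C x"
    using assms by (auto simp: bam_def mult_le_0_iff)
  then show "x \<in> C" using proj_in by metis
next
  fix x assume "x \<in> C"
  then have "norm (T x - x) \<le> 0" using assms unfolding bam_def by (auto dest: spec[of _ x])
  then show "x \<in> Fix T" by (simp add: Fix_def)
qed

lemma bam_imp_is_gamma_BAM: "bam \<gamma> C T \<Longrightarrow> is_gamma_BAM \<gamma> T"
  unfolding is_gamma_BAM_def bam_Fix
  using affine_imp_convex[OF affine] closed nonempty by (simp add: bam_def fun_eq_iff)

text \<open>The iterates all have the same projection onto \<open>C\<close>, so the contraction
  keeps the same target at each step.\<close>

lemma bam_funpow:
  assumes "bam \<gamma> C T"
  shows "norm ((T ^^ k) x - proj C x) \<le> \<gamma> ^ k * norm (x - proj C x)"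
proof -
  have P: "proj C ((T ^^ k) x) = proj C x" for k
    using assms by (induction k) (auto simp: bam_def)
  show ?thesis
  proof (induction k)
    case (Suc k)
    have "norm ((T ^^ Suc k) x - proj C x) \<le> \<gamma> * norm ((T ^^ k) x - proj C x)"
      using assms P[of k] unfolding bam_def by (metis comp_apply funpow.simps(2))
    also have "\<dots> \<le> \<gamma> * (\<gamma> ^ k * norm (x - proj C x))"
      using Suc assms by (intro mult_left_mono) (auto simp: bam_def)
    finally show ?case by (simp add: mult.assoc)
  qed simp
qed

text \<open>\<open>x\<close> and \<open>T x\<close> have the same projection onto \<open>C\<close>.
  Pythagoras splits both squared distances to \<open>p\<close> there, and the common term
  cancels.\<close>

lemma bam_descent:
  assumes "bam \<gamma> C T" "p \<in> C"
  shows "(1 - \<gamma>\<^sup>2) * (norm (x - proj C x))\<^sup>2 \<le> (norm (x - p))\<^sup>2 - (norm (T x - p))\<^sup>2"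
proof -
  have "(norm (T x - proj C x))\<^sup>2 \<le> (\<gamma> * norm (x - proj C x))\<^sup>2"
    using assms(1) by (intro power_mono) (auto simp: bam_def)
  moreover have "proj C (T x) = proj C x" using assms(1) by (simp add: bam_def)
  ultimately show ?thesis
    using norm_proj_pythagoras[OF assms(2), of "T x" x] norm_proj_pythagoras[OF assms(2), of x x]
    by (simp add: power_mult_distrib algebra_simps)
qed

text \<open>Both \<open>x\<close> and \<open>T x\<close> lie in the ball around
  \<open>proj C x\<close> whose radius is the distance of \<open>x\<close> to
  \<open>C\<close>.\<close>

lemma bam_displacement:
  assumes "bam \<gamma> C T"
  shows "norm (T x - x) \<le> 2 * norm (x - proj C x)"
proof -
  have "norm (T x - proj C x) \<le> \<gamma> * norm (x - proj C x)" using assms by (simp add: bam_def)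
  also have "\<dots> \<le> 1 * norm (x - proj C x)"
    using assms by (intro mult_right_mono) (auto simp: bam_def)
  finally show ?thesis
    using norm_triangle_ineq4[of "T x - proj C x" "x - proj C x"] by simp
qed

lemma bam_orth:
  assumes "bam \<gamma> C T" "y \<in> C" "y' \<in> C"
  shows "(T x - x) \<bullet> (y - y') = 0"
proof -
  have "proj C (T x) = proj C x" using assms(1) by (simp add: bam_def)
  then show ?thesis using assms(2,3) unfolding proj_eq_iff by simp
qed

end

section \<open>Best approximation mappings from descent: compositions and convex
  combinations\<close>

text \<open>Shared last step for compositions and convex combinations. Descent controls the distance
  to each member, regularity turns this into the distance to the intersection, and hence the squared
  distance shrinks by a fixed fraction.\<close>

lemma bam_if_regular_descent:
  fixes U :: "'i \<Rightarrow> 'a::{real_inner, complete_space} set"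
  assumes fin: "finite J" and J: "J \<noteq> {}" and U: "\<And>j. j \<in> J \<Longrightarrow> closed_affine (U j)"
    and ne: "(\<Inter>j\<in>J. U j) \<noteq> {}" and reg: "linearly_regular J U"
    and orth: "\<And>x y y'. y \<in> (\<Inter>j\<in>J. U j) \<Longrightarrow> y' \<in> (\<Inter>j\<in>J. U j) \<Longrightarrow> (T x - x) \<bullet> (y - y') = 0"
    and c: "0 < c"
    and descent: "\<And>x p j. p \<in> (\<Inter>j\<in>J. U j) \<Longrightarrow> j \<in> J \<Longrightarrow>
      (norm (x - proj (U j) x))\<^sup>2 \<le> c * ((norm (x - p))\<^sup>2 - (norm (T x - p))\<^sup>2)"
  shows "\<exists>\<gamma>. bam \<gamma> (\<Inter>j\<in>J. U j) T"
proof -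
  let ?C = "\<Inter>j\<in>J. U j"
  interpret closed_affine ?C using U ne by (rule closed_affine_Inter)
  obtain \<kappa> where \<kappa>: "0 \<le> \<kappa>"
    "\<And>x. norm (x - proj ?C x) \<le> \<kappa> * (\<Sum>j\<in>J. norm (x - proj (U j) x))"
    using reg unfolding linearly_regular_def by blast
  \<comment> \<open>Bounding each distance by \<open>sqrt (c * \<phi>)\<close>, summing over
    \<open>J\<close> and squaring the regularity estimate gives the product. The summand 1 ensures
    \<open>1 \<le> K\<close>, so that \<open>1 - 1 / K\<close> lies in \<open>[0,1[\<close>.\<close>
  define K where "K = \<kappa>\<^sup>2 * (real (card J))\<^sup>2 * c + 1"
  have K: "1 \<le> K" using c by (simp add: K_def)
  have main: "(norm (T x - proj ?C x))\<^sup>2 \<le> (1 - 1 / K) * (norm (x - proj ?C x))\<^sup>2" for x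
  proof -
    define \<phi> where "\<phi> = (norm (x - proj ?C x))\<^sup>2 - (norm (T x - proj ?C x))\<^sup>2"
    have d: "(norm (x - proj (U j) x))\<^sup>2 \<le> c * \<phi>" if "j \<in> J" for j
      using descent[OF proj_in that] unfolding \<phi>_def .
    have c\<phi>: "0 \<le> c * \<phi>"
      using d J by (meson ex_in_conv order_trans zero_le_power2)
    have "norm (x - proj (U j) x) \<le> sqrt (c * \<phi>)" if "j \<in> J" for j
      using d[OF that] by (rule real_le_rsqrt)
    then have "(\<Sum>j\<in>J. norm (x - proj (U j) x)) \<le> real (card J) * sqrt (c * \<phi>)"
      by (rule sum_bounded_above)
    then have "norm (x - proj ?C x) \<le> \<kappa> * (real (card J) * sqrt (c * \<phi>))"
      using \<kappa> mult_left_mono order_trans by blast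
    then have "(norm (x - proj ?C x))\<^sup>2 \<le> (\<kappa> * (real (card J) * sqrt (c * \<phi>)))\<^sup>2"
      by (intro power_mono) auto
    also have "\<dots> = \<kappa>\<^sup>2 * (real (card J))\<^sup>2 * c * \<phi>"
      using c\<phi> by (simp add: power_mult_distrib)
    finally have le: "(norm (x - proj ?C x))\<^sup>2 \<le> (K - 1) * \<phi>" by (simp add: K_def)
    have "0 \<le> \<phi>" using c\<phi> c by (simp add: zero_le_mult_iff)
    then have "(norm (x - proj ?C x))\<^sup>2 \<le> K * \<phi>" using le by (simp add: algebra_simps)
    then show ?thesis using K by (simp add: \<phi>_def field_simps)
  qed
  have "bam (sqrt (1 - 1 / K)) ?C T"
    unfolding bam_def
  proof (intro conjI allI)
    show "0 \<le> sqrt (1 - 1 / K)" "sqrt (1 - 1 / K) < 1" using K by auto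
  next
    fix x
    show "proj ?C (T x) = proj ?C x" unfolding proj_eq_iff using orth by blast
    show "norm (T x - proj ?C x) \<le> sqrt (1 - 1 / K) * norm (x - proj ?C x)"
      using real_le_rsqrt[OF main[of x]] by (simp add: real_sqrt_mult)
  qed
  then show ?thesis ..
qed

lemma norm_add_sq_le: "(norm (u + v))\<^sup>2 \<le> 2 * (norm u)\<^sup>2 + 2 * (norm (v::'a::real_inner))\<^sup>2"
proof -
  have "0 \<le> (norm (u - v))\<^sup>2" by simp
  then show ?thesis
    by (simp add: power2_norm_eq_inner inner_add_left inner_add_right inner_diff_left
        inner_diff_right inner_commute)
qed

lemma bam_constant_pos: "bam \<gamma> C T \<Longrightarrow> 0 < 1 - \<gamma>\<^sup>2"
  by (simp add: bam_def power_less_one_iff abs_square_less_1)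

text \<open>The bound on the displacement \<open>F x - x\<close> is only needed to push the induction through.\<close>

lemma fold_bam_descent:
  fixes U :: "'i \<Rightarrow> 'a::{real_inner, complete_space} set"
  assumes "\<forall>i\<in>set xs. closed_affine (U i) \<and> (\<exists>\<gamma>. bam \<gamma> (U i) (T i))"
  defines "F \<equiv> fold (\<lambda>i F. T i \<circ> F) xs id"
  shows "(\<forall>x. \<forall>y\<in>(\<Inter>i\<in>set xs. U i). \<forall>y'\<in>(\<Inter>i\<in>set xs. U i). (F x - x) \<bullet> (y - y') = 0) \<and>
    (\<exists>c>0. \<forall>x. \<forall>p\<in>(\<Inter>i\<in>set xs. U i).
      (norm (F x - x))\<^sup>2 \<le> c * ((norm (x - p))\<^sup>2 - (norm (F x - p))\<^sup>2) \<and>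
      (\<forall>i\<in>set xs. (norm (x - proj (U i) x))\<^sup>2 \<le> c * ((norm (x - p))\<^sup>2 - (norm (F x - p))\<^sup>2)))"
  using assms(1) unfolding F_def
\<comment> \<open>The fold applies the head of the list first, so appending \<open>i\<close> puts
  \<open>T i\<close> on the outside of the composition.\<close>
proof (induction xs rule: rev_induct)
  case Nil
  then show ?case by (auto intro!: exI[of _ 1])
next
  case (snoc i xs)
  define F where "F = fold (\<lambda>i F. T i \<circ> F) xs id"
  let ?C = "\<Inter>j\<in>set xs. U j"
  have F': "fold (\<lambda>i F. T i \<circ> F) (xs @ [i]) id x = T i (F x)" for x by (simp add: F_def)
  have C': "(\<Inter>j\<in>set (xs @ [i]). U j) = U i \<inter> ?C" by auto
  interpret Ui: closed_affine "U i" using snoc.prems by simp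
  obtain \<gamma> where \<gamma>: "bam \<gamma> (U i) (T i)" using snoc.prems by force
  have "\<forall>j\<in>set xs. closed_affine (U j) \<and> (\<exists>\<gamma>. bam \<gamma> (U j) (T j))" using snoc.prems by simp
  note IH = snoc.IH[OF this, folded F_def]
  have orth: "(F x - x) \<bullet> (y - y') = 0" if "y \<in> ?C" "y' \<in> ?C" for x y y'
    using IH that by blast
  obtain c where c: "0 < c"
    and disp: "\<And>x p. p \<in> ?C \<Longrightarrow> (norm (F x - x))\<^sup>2 \<le> c * ((norm (x - p))\<^sup>2 - (norm (F x - p))\<^sup>2)"
    and dist: "\<And>x p j. p \<in> ?C \<Longrightarrow> j \<in> set xs \<Longrightarrow>
      (norm (x - proj (U j) x))\<^sup>2 \<le> c * ((norm (x - p))\<^sup>2 - (norm (F x - p))\<^sup>2)"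
    using IH by blast
  define b where "b = 1 / (1 - \<gamma>\<^sup>2)"
  have b: "0 < b" using bam_constant_pos[OF \<gamma>] by (simp add: b_def)
  have orth': "(T i (F x) - x) \<bullet> (y - y') = 0" if "y \<in> U i \<inter> ?C" "y' \<in> U i \<inter> ?C" for x y y'
    using orth[of y y' x] Ui.bam_orth[OF \<gamma>, of y y' "F x"] that by (simp add: inner_diff_left)
  \<comment> \<open>The displacement of the longer composition costs
    \<open>2 * c * \<phi> + 8 * b * \<psi>\<close>, with \<open>\<phi>\<close> and
    \<open>\<psi>\<close> as below; the distance to \<open>U i\<close> costs
    \<open>2 * c * \<phi> + 2 * b * \<psi>\<close>.\<close>
  define c' where "c' = 2 * c + 8 * b"
  have c': "0 < c'" using c b by (simp add: c'_def)
  have main: "(norm (T i (F x) - x))\<^sup>2 \<le> c' * ((norm (x - p))\<^sup>2 - (norm (T i (F x) - p))\<^sup>2) \<and>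
      (\<forall>j\<in>set (xs @ [i]). (norm (x - proj (U j) x))\<^sup>2
        \<le> c' * ((norm (x - p))\<^sup>2 - (norm (T i (F x) - p))\<^sup>2))"
    if p: "p \<in> U i \<inter> ?C" for x p
  proof -
    \<comment> \<open>The decreases achieved by \<open>F\<close> and by the final
      \<open>T i\<close>. Both are nonnegative and they add up to the total decrease.\<close>
    define \<phi> \<psi> where "\<phi> = (norm (x - p))\<^sup>2 - (norm (F x - p))\<^sup>2"
      and "\<psi> = (norm (F x - p))\<^sup>2 - (norm (T i (F x) - p))\<^sup>2"
    define d where "d = norm (F x - proj (U i) (F x))"
    have sum: "(norm (x - p))\<^sup>2 - (norm (T i (F x) - p))\<^sup>2 = \<phi> + \<psi>"
      by (simp add: \<phi>_def \<psi>_def)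
    have disp': "(norm (F x - x))\<^sup>2 \<le> c * \<phi>" using disp p unfolding \<phi>_def by blast
    have \<phi>: "0 \<le> \<phi>" using order_trans[OF zero_le_power2 disp'] c by (simp add: zero_le_mult_iff)
    have "(1 - \<gamma>\<^sup>2) * d\<^sup>2 \<le> \<psi>" using Ui.bam_descent[OF \<gamma>] p unfolding d_def \<psi>_def by blast
    then have d: "d\<^sup>2 \<le> b * \<psi>" using bam_constant_pos[OF \<gamma>] by (simp add: b_def field_simps)
    have \<psi>: "0 \<le> \<psi>" using order_trans[OF zero_le_power2 d] b by (simp add: zero_le_mult_iff)
    have pos: "0 \<le> c * \<phi>" "0 \<le> c * \<psi>" "0 \<le> b * \<phi>" "0 \<le> b * \<psi>" using b c \<phi> \<psi> by simp_all
    have "(norm (T i (F x) - F x))\<^sup>2 \<le> (2 * d)\<^sup>2"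
      using Ui.bam_displacement[OF \<gamma>] unfolding d_def by (intro power_mono) auto
    then have "(norm (T i (F x) - F x))\<^sup>2 \<le> 4 * (b * \<psi>)" using d by (simp add: power_mult_distrib)
    then have "(norm (T i (F x) - x))\<^sup>2 \<le> 2 * (4 * (b * \<psi>)) + 2 * (c * \<phi>)"
      using norm_add_sq_le[of "T i (F x) - F x" "F x - x"] disp' by simp
    also have "\<dots> \<le> c' * (\<phi> + \<psi>)" using pos by (simp add: c'_def algebra_simps)
    finally have 1: "(norm (T i (F x) - x))\<^sup>2 \<le> c' * (\<phi> + \<psi>)" .
    \<comment> \<open>\<open>T i\<close> acts at \<open>F x\<close>, so its descent controls the
      distance of \<open>F x\<close> to \<open>U i\<close>; the displacement bound carries this back
      to \<open>x\<close>.\<close>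
    have "(norm (x - proj (U i) x))\<^sup>2 \<le> (norm (x - proj (U i) (F x)))\<^sup>2"
      by (intro power_mono Ui.norm_proj_le) auto
    also have "\<dots> \<le> 2 * (norm (F x - x))\<^sup>2 + 2 * d\<^sup>2"
      using norm_add_sq_le[of "x - F x" "F x - proj (U i) (F x)"]
      by (simp add: d_def norm_minus_commute)
    also have "\<dots> \<le> c' * (\<phi> + \<psi>)" using disp' d pos by (simp add: c'_def algebra_simps)
    finally have 2: "(norm (x - proj (U i) x))\<^sup>2 \<le> c' * (\<phi> + \<psi>)" .
    have 3: "(norm (x - proj (U j) x))\<^sup>2 \<le> c' * (\<phi> + \<psi>)" if "j \<in> set xs" for j
    proof -
      have "(norm (x - proj (U j) x))\<^sup>2 \<le> c * \<phi>" using dist that p unfolding \<phi>_def by blast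
      then show ?thesis using pos by (simp add: c'_def algebra_simps)
    qed
    show ?thesis unfolding sum using 1 2 3 by auto
  qed
  show ?case
    unfolding C' F'
  proof (rule conjI, goal_cases)
    case 1
    show ?case by (intro allI ballI orth')
  next
    case 2
    show ?case by (rule exI[of _ c'], rule conjI[OF c'], intro allI ballI, rule main)
  qed
qed

lemma bam_fold:
  fixes U :: "'i \<Rightarrow> 'a::{real_inner, complete_space} set"
  assumes "xs \<noteq> []" and U: "\<And>i. i \<in> set xs \<Longrightarrow> closed_affine (U i)"
    and bam: "\<And>i. i \<in> set xs \<Longrightarrow> \<exists>\<gamma>. bam \<gamma> (U i) (T i)"
    and ne: "(\<Inter>i\<in>set xs. U i) \<noteq> {}" and reg: "linearly_regular (set xs) U"
  shows "\<exists>\<gamma>. bam \<gamma> (\<Inter>i\<in>set xs. U i) (fold (\<lambda>i F. T i \<circ> F) xs id)"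
proof -
  let ?F = "fold (\<lambda>i F. T i \<circ> F) xs id"
  have *: "(\<forall>x. \<forall>y\<in>(\<Inter>i\<in>set xs. U i). \<forall>y'\<in>(\<Inter>i\<in>set xs. U i). (?F x - x) \<bullet> (y - y') = 0) \<and>
    (\<exists>c>0. \<forall>x. \<forall>p\<in>(\<Inter>i\<in>set xs. U i).
      (norm (?F x - x))\<^sup>2 \<le> c * ((norm (x - p))\<^sup>2 - (norm (?F x - p))\<^sup>2) \<and>
      (\<forall>i\<in>set xs. (norm (x - proj (U i) x))\<^sup>2 \<le> c * ((norm (x - p))\<^sup>2 - (norm (?F x - p))\<^sup>2)))"
    using U bam by (intro fold_bam_descent) blast
  then obtain c where c: "0 < c" and descent: "\<forall>x. \<forall>p\<in>(\<Inter>i\<in>set xs. U i). \<forall>i\<in>set xs.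
      (norm (x - proj (U i) x))\<^sup>2 \<le> c * ((norm (x - p))\<^sup>2 - (norm (?F x - p))\<^sup>2)"
    by blast
  show ?thesis
  proof (rule bam_if_regular_descent[OF finite_set _ U ne reg _ c])
    show "set xs \<noteq> {}" using assms(1) by simp
    show "(?F x - x) \<bullet> (y - y') = 0"
      if "y \<in> (\<Inter>i\<in>set xs. U i)" "y' \<in> (\<Inter>i\<in>set xs. U i)" for x y y'
      using * that by blast
    show "(norm (x - proj (U j) x))\<^sup>2 \<le> c * ((norm (x - p))\<^sup>2 - (norm (?F x - p))\<^sup>2)"
      if "p \<in> (\<Inter>i\<in>set xs. U i)" "j \<in> set xs" for x p j
      using descent that by blast
  qed
qed

text \<open>The triangle inequality followed by Jensen's inequality for the square.\<close>

lemma norm_sq_convex_combination: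
  fixes u :: "'i \<Rightarrow> 'a::real_normed_vector"
  assumes "finite J" "\<And>i. i \<in> J \<Longrightarrow> 0 \<le> \<omega> i" "(\<Sum>i\<in>J. \<omega> i) = 1"
  shows "(norm (\<Sum>i\<in>J. \<omega> i *\<^sub>R u i))\<^sup>2 \<le> (\<Sum>i\<in>J. \<omega> i * (norm (u i))\<^sup>2)"
proof -
  have "J \<noteq> {}" using assms(3) by auto
  have "norm (\<Sum>i\<in>J. \<omega> i *\<^sub>R u i) \<le> (\<Sum>i\<in>J. \<omega> i *\<^sub>R norm (u i))"
    by (rule sum_norm_le) (simp add: assms(2))
  then have "(norm (\<Sum>i\<in>J. \<omega> i *\<^sub>R u i))\<^sup>2 \<le> (\<Sum>i\<in>J. \<omega> i *\<^sub>R norm (u i))\<^sup>2"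
    by (rule power_mono) simp
  also have "\<dots> \<le> (\<Sum>i\<in>J. \<omega> i * (norm (u i))\<^sup>2)"
    using convex_on_sum[OF assms(1) \<open>J \<noteq> {}\<close> convex_power2, of \<omega> "\<lambda>i. norm (u i)"] assms by simp
  finally show ?thesis .
qed

text \<open>Convexity of the squared norm averages the individual descents. Positive weights keep a
  share of each, so the total descent controls every single distance.\<close>

lemma bam_convex_combination:
  fixes U :: "'i \<Rightarrow> 'a::{real_inner, complete_space} set"
  assumes fin: "finite J" and U: "\<And>i. i \<in> J \<Longrightarrow> closed_affine (U i)"
    and bam: "\<And>i. i \<in> J \<Longrightarrow> \<exists>\<gamma>. bam \<gamma> (U i) (T i)"
    and ne: "(\<Inter>i\<in>J. U i) \<noteq> {}" and reg: "linearly_regular J U"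
    and \<omega>: "\<And>i. i \<in> J \<Longrightarrow> 0 < \<omega> i" and sum1: "(\<Sum>i\<in>J. \<omega> i) = 1"
  shows "\<exists>\<gamma>. bam \<gamma> (\<Inter>i\<in>J. U i) (\<lambda>x. \<Sum>i\<in>J. \<omega> i *\<^sub>R T i x)"
proof -
  have J: "J \<noteq> {}" using sum1 by auto
  obtain \<gamma> where \<gamma>: "\<And>i. i \<in> J \<Longrightarrow> bam (\<gamma> i) (U i) (T i)" using bam by metis
  define a where "a i = \<omega> i * (1 - (\<gamma> i)\<^sup>2)" for i
  have a: "0 < a i" if "i \<in> J" for i
    using \<omega>[OF that] bam_constant_pos[OF \<gamma>[OF that]] by (simp add: a_def)
  \<comment> \<open>The sum of the positive numbers \<open>1 / a i\<close> serves as a common upper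
    bound for them.\<close>
  define c where "c = (\<Sum>i\<in>J. 1 / a i)"
  have c: "0 < c" unfolding c_def using fin J a by (intro sum_pos) auto
  have diff: "(\<Sum>i\<in>J. \<omega> i *\<^sub>R T i x) - p = (\<Sum>i\<in>J. \<omega> i *\<^sub>R (T i x - p))" for x p
    using sum1 by (simp add: scaleR_diff_right sum_subtractf scaleR_sum_left[symmetric])
  show ?thesis
  proof (rule bam_if_regular_descent[OF fin J U ne reg _ c])
    fix x y y' assume y: "y \<in> (\<Inter>i\<in>J. U i)" "y' \<in> (\<Inter>i\<in>J. U i)"
    have "(T i x - x) \<bullet> (y - y') = 0" if "i \<in> J" for i
      using closed_affine.bam_orth[OF U[OF that] \<gamma>[OF that]] y that by blast
    then show "((\<Sum>i\<in>J. \<omega> i *\<^sub>R T i x) - x) \<bullet> (y - y') = 0"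
      unfolding diff by (simp add: inner_sum_left)
  next
    fix x p j assume p: "p \<in> (\<Inter>i\<in>J. U i)" and j: "j \<in> J"
    let ?d = "\<lambda>i. (norm (x - proj (U i) x))\<^sup>2"
    let ?\<phi> = "(norm (x - p))\<^sup>2 - (norm ((\<Sum>i\<in>J. \<omega> i *\<^sub>R T i x) - p))\<^sup>2"
    have "(norm ((\<Sum>i\<in>J. \<omega> i *\<^sub>R T i x) - p))\<^sup>2 \<le> (\<Sum>i\<in>J. \<omega> i * (norm (T i x - p))\<^sup>2)"
      unfolding diff using fin \<omega> sum1 by (intro norm_sq_convex_combination) (auto intro: less_imp_le)
    also have "\<dots> \<le> (\<Sum>i\<in>J. \<omega> i * (norm (x - p))\<^sup>2 - a i * ?d i)"
    proof (rule sum_mono)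
      fix i assume i: "i \<in> J"
      have "(1 - (\<gamma> i)\<^sup>2) * ?d i \<le> (norm (x - p))\<^sup>2 - (norm (T i x - p))\<^sup>2"
        using closed_affine.bam_descent[OF U[OF i] \<gamma>[OF i]] p i by blast
      then have "\<omega> i * ((1 - (\<gamma> i)\<^sup>2) * ?d i) \<le> \<omega> i * ((norm (x - p))\<^sup>2 - (norm (T i x - p))\<^sup>2)"
        using \<omega>[OF i] by (intro mult_left_mono) auto
      then show "\<omega> i * (norm (T i x - p))\<^sup>2 \<le> \<omega> i * (norm (x - p))\<^sup>2 - a i * ?d i"
        by (simp add: a_def algebra_simps)
    qed
    also have "\<dots> = (norm (x - p))\<^sup>2 - (\<Sum>i\<in>J. a i * ?d i)"
      by (simp add: sum_subtractf sum_distrib_right[symmetric] sum1)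
    finally have "(\<Sum>i\<in>J. a i * ?d i) \<le> ?\<phi>" by simp
    moreover have "a j * ?d j \<le> (\<Sum>i\<in>J. a i * ?d i)"
      using a by (intro member_le_sum j fin) (auto intro!: mult_nonneg_nonneg intro: less_imp_le)
    ultimately have le: "a j * ?d j \<le> ?\<phi>" by simp
    moreover have "0 \<le> a j * ?d j" using a[OF j] by simp
    ultimately have \<phi>: "0 \<le> ?\<phi>" by linarith
    have "?d j \<le> (1 / a j) * ?\<phi>" using le a[OF j] by (simp add: field_simps)
    also have "\<dots> \<le> c * ?\<phi>"
      unfolding c_def using a fin j \<phi>
      by (intro mult_right_mono member_le_sum[of j J "\<lambda>i. 1 / a i"]) (auto intro: less_imp_le)
    finally show "?d j \<le> c * ?\<phi>" .
  qed
qed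

subsection \<open>Circumcenter mappings\<close>

text \<open>Gram-Schmidt by induction on the spanning set. It supplies the projection onto the
  affine hull of the finitely many points that define a circumcenter.\<close>

lemma finite_span_orthogonal_decomposition:
  fixes X :: "'a::real_inner set"
  assumes "finite X"
  shows "\<exists>q\<in>span X. \<forall>s\<in>span X. (y - q) \<bullet> s = 0"
proof -
  have "\<exists>q\<in>span X. \<forall>s\<in>X. (y - q) \<bullet> s = 0"
    using assms
  proof (induction X arbitrary: y)
    case (insert x X)
    have ortho: "(u - q) \<bullet> s = 0" if "\<forall>s\<in>X. (u - q) \<bullet> s = 0" "s \<in> span X" for u q s
      using orthogonal_to_span[OF that(2)] that(1) by (auto simp: orthogonal_def)
    obtain q where q: "q \<in> span X" "\<forall>s\<in>X. (y - q) \<bullet> s = 0" using insert.IH by blast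
    obtain x0 where x0: "x0 \<in> span X" "\<forall>s\<in>X. (x - x0) \<bullet> s = 0" using insert.IH by blast
    define e where "e = x - x0"
    \<comment> \<open>\<open>e\<close> is the part of \<open>x\<close> orthogonal to
      \<open>span X\<close>, and \<open>r\<close> adds the component of \<open>y - q\<close> along
      it. If \<open>e = 0\<close>, the added term vanishes and \<open>r = q\<close>.\<close>
    define r where "r = q + ((y - q) \<bullet> e / (e \<bullet> e)) *\<^sub>R e"
    have mono: "span X \<subseteq> span (insert x X)" by (rule span_mono) blast
    have "e \<in> span (insert x X)"
      unfolding e_def using mono x0 by (intro span_diff) (auto intro: span_base)
    then have r: "r \<in> span (insert x X)"
      unfolding r_def using mono q by (intro span_add span_scale) auto
    have rs: "(y - r) \<bullet> s = 0" if "s \<in> X" for s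
      using q(2) x0(2) that by (simp add: r_def e_def[symmetric] inner_diff_left inner_add_left)
    have re: "(y - r) \<bullet> e = 0"
      by (cases "e = 0") (simp_all add: r_def inner_diff_left inner_add_left)
    have "(y - r) \<bullet> x0 = 0" using ortho[of y r x0] rs x0(1) by blast
    then have "(y - r) \<bullet> x = 0" using re by (simp add: e_def inner_diff_right)
    then show ?case using r rs by blast
  qed simp
  then show ?thesis
    using orthogonal_to_span by (metis orthogonal_def)
qed

text \<open>A level set of \<open>\<lambda>y. w \<bullet> y\<close> is affine, so one that contains
  \<open>X\<close> contains its affine hull.\<close>

lemma inner_affine_hull_const:
  fixes w :: "'a::real_inner"
  assumes "\<And>s s'. s \<in> X \<Longrightarrow> s' \<in> X \<Longrightarrow> w \<bullet> (s - s') = 0"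
    and "q \<in> affine hull X" "q' \<in> affine hull X"
  shows "w \<bullet> (q - q') = 0"
proof -
  obtain s where s: "s \<in> X" using assms(2) by (metis affine_hull_empty all_not_in_conv)
  have "affine hull X \<subseteq> {y. w \<bullet> y = w \<bullet> s}"
  proof (rule hull_minimal)
    show "X \<subseteq> {y. w \<bullet> y = w \<bullet> s}" using assms(1)[OF _ s] by (simp add: subset_eq inner_diff_right)
  qed (rule affine_hyperplane)
  then have "w \<bullet> q = w \<bullet> s" "w \<bullet> q' = w \<bullet> s" using assms(2,3) by blast+
  then show ?thesis by (simp add: inner_diff_right)
qed

text \<open>If \<open>w\<close> is equidistant from the points \<open>T x\<close>, then so is its
  projection onto their affine hull, by Pythagoras. This gives existence of the circumcenter;
  uniqueness holds because two equidistant points of the hull differ by a vector orthogonal to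
  it.\<close>

lemma CC_eq_nearest_point:
  fixes w :: "'a::real_inner"
  assumes fin: "finite S" and ne: "S \<noteq> {}" and w: "\<And>T. T \<in> S \<Longrightarrow> norm (w - T x) = r"
  defines "H \<equiv> affine hull ((\<lambda>T. T x) ` S)"
  shows "CC S x \<in> H" "\<And>y. y \<in> H \<Longrightarrow> (w - CC S x) \<bullet> (y - CC S x) = 0"
proof -
  define X where "X = (\<lambda>T. T x) ` S"
  obtain s where s: "s \<in> X" using ne by (auto simp: X_def)
  have H: "H = (\<lambda>v. s + v) ` span ((\<lambda>t. - s + t) ` X)"
    using affine_hull_insert_span_gen[of s X] s by (simp add: H_def X_def[symmetric] insert_absorb)
  obtain v where v: "v \<in> span ((\<lambda>t. - s + t) ` X)"
    "\<And>u. u \<in> span ((\<lambda>t. - s + t) ` X) \<Longrightarrow> ((w - s) - v) \<bullet> u = 0"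
    using finite_span_orthogonal_decomposition[of "(\<lambda>t. - s + t) ` X" "w - s"] fin
    unfolding X_def by blast
  define q where "q = s + v"
  have q: "q \<in> H" unfolding H q_def using v(1) by blast
  have orth: "(w - q) \<bullet> (y - y') = 0" if H': "y \<in> H" "y' \<in> H" for y y'
  proof -
    obtain u u' where "y = s + u" "y' = s + u'" "u \<in> span ((\<lambda>t. - s + t) ` X)" "u' \<in> span ((\<lambda>t. - s + t) ` X)"
      using H' unfolding H by blast
    then show ?thesis using v(2)[of u] v(2)[of u'] by (simp add: q_def diff_diff_eq inner_diff_right)
  qed
  have X: "t \<in> H" if "t \<in> X" for t
    using that hull_inc unfolding H_def X_def by metis
  have dist: "(norm (q - t))\<^sup>2 = r\<^sup>2 - (norm (w - q))\<^sup>2" if t: "t \<in> X" for t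
  proof -
    have "(norm (w - t))\<^sup>2 = (norm (w - q))\<^sup>2 + (norm (q - t))\<^sup>2"
      using pythagoras[of "w - q" "q - t"] orth[OF q X[OF t]] by simp
    moreover have "norm (w - t) = r" using t w by (auto simp: X_def)
    ultimately show ?thesis by simp
  qed
  have "CC S x = q"
    unfolding CC_def
  proof (rule the_equality, intro conjI)
    show "q \<in> affine hull ((\<lambda>T. T x) ` S)" using q unfolding H_def .
    have "norm (q - T x) = sqrt (r\<^sup>2 - (norm (w - q))\<^sup>2)" if "T \<in> S" for T
      using dist[of "T x"] that by (intro real_sqrt_unique[symmetric]) (auto simp: X_def)
    then have "(\<lambda>T. norm (q - T x)) ` S = {sqrt (r\<^sup>2 - (norm (w - q))\<^sup>2)}"
      using ne by auto
    then show "is_singleton ((\<lambda>T. norm (q - T x)) ` S)" by simp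
  next
    fix p assume p: "p \<in> affine hull ((\<lambda>T. T x) ` S) \<and> is_singleton ((\<lambda>T. norm (p - T x)) ` S)"
    then obtain \<rho> where "(\<lambda>T. norm (p - T x)) ` S = {\<rho>}" unfolding is_singleton_def by blast
    then have \<rho>: "norm (p - t) = \<rho>" if "t \<in> X" for t using that by (auto simp: X_def)
    \<comment> \<open>In the difference of the squared distances from \<open>p\<close> and
      \<open>q\<close> to \<open>t\<close>, the square of \<open>t\<close> cancels; comparing
      \<open>t\<close> with \<open>t'\<close> leaves a linear condition.\<close>
    have "(p - q) \<bullet> (t - t') = 0" if "t \<in> X" "t' \<in> X" for t t'
    proof -
      have "(norm (p - t))\<^sup>2 - (norm (q - t))\<^sup>2 = (norm (p - t'))\<^sup>2 - (norm (q - t'))\<^sup>2"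
        using \<rho> dist that by simp
      then show ?thesis
        by (simp add: power2_norm_eq_inner inner_diff_left inner_diff_right inner_commute)
    qed
    then have "(p - q) \<bullet> (p - q) = 0"
      using p q unfolding H_def X_def[symmetric] by (blast intro: inner_affine_hull_const)
    then show "p = q" by simp
  qed
  then show "CC S x \<in> H" "\<And>y. y \<in> H \<Longrightarrow> (w - CC S x) \<bullet> (y - CC S x) = 0"
    using q orth by auto
qed

context closed_affine
begin

lemma reflector_orth:
  assumes "y \<in> C" "y' \<in> C"
  shows "(reflector C x - x) \<bullet> (y - y') = 0"
proof -
  have "reflector C x - x = - 2 *\<^sub>R (x - proj C x)"
    by (simp add: reflector_def algebra_simps scaleR_2)
  then show ?thesis using proj_orth[OF assms] by simp
qed

text \<open>Reflection flips the component normal to \<open>C\<close> and keeps the component along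
  \<open>C\<close>; these are orthogonal.\<close>

lemma norm_reflector:
  assumes "y \<in> C"
  shows "norm (reflector C x - y) = norm (x - y)"
proof -
  have eq: "reflector C x - y = (proj C x - x) + (proj C x - y)"
    by (simp add: reflector_def algebra_simps scaleR_2)
  have "(proj C x - x) \<bullet> (proj C x - y) = 0"
    using proj_orth[OF proj_in assms, of x x] by (simp add: inner_diff_left)
  then have "(norm (reflector C x - y))\<^sup>2 = (norm (x - y))\<^sup>2"
    unfolding eq using norm_proj_pythagoras[OF assms refl, of x]
    by (simp add: pythagoras norm_minus_commute)
  then show ?thesis by simp
qed

lemma proj_eq_midpoint_reflector: "proj C x = (1/2) *\<^sub>R (x + reflector C x)"
  by (simp add: reflector_def)

end

lemma bam_CC:
  fixes A B :: "'a::{real_inner, complete_space} set"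
  assumes A: "closed_affine A" and B: "closed_affine B" and ne: "A \<inter> B \<noteq> {}"
    and bam: "bam \<gamma> (A \<inter> B) (proj B \<circ> proj A)"
    and S: "S = {id, reflector A, reflector B, reflector B \<circ> reflector A}"
  shows "bam \<gamma> (A \<inter> B) (CC S)"
proof -
  interpret A: closed_affine A by fact
  interpret B: closed_affine B by fact
  interpret M: closed_affine "A \<inter> B" using A B ne by (rule closed_affine_Int)
  have main: "proj (A \<inter> B) (CC S x) = proj (A \<inter> B) x \<and>
      norm (CC S x - proj (A \<inter> B) x) \<le> \<gamma> * norm (x - proj (A \<inter> B) x)" for x
  proof -
    define X where "X = (\<lambda>T. T x) ` S"
    define w where "w = proj (A \<inter> B) x"
    let ?a = "reflector A x" and ?b = "reflector B x" and ?c = "reflector B (reflector A x)"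
    have X: "X = {x, ?a, ?b, ?c}" by (simp add: X_def S)
    have w: "w \<in> A" "w \<in> B" using M.proj_in[of x] by (auto simp: w_def)
    \<comment> \<open>\<open>w\<close> lies in both subspaces, so each reflector preserves the
      distance to it.\<close>
    have dist: "norm (w - T x) = norm (w - x)" if "T \<in> S" for T
      using that w A.norm_reflector B.norm_reflector
      by (auto simp: S norm_minus_commute[of w])
    have fin: "finite S" and neS: "S \<noteq> {}" by (simp_all add: S)
    have CC: "CC S x \<in> affine hull X"
      "\<And>y. y \<in> affine hull X \<Longrightarrow> (w - CC S x) \<bullet> (y - CC S x) = 0"
      unfolding X_def using CC_eq_nearest_point[OF fin neS, of w x "norm (w - x)"] dist by blast+
    \<comment> \<open>Reflections move points orthogonally to the directions of
      \<open>A \<inter> B\<close>. This holds for the four points and passes to their affine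
      hull.\<close>
    have "(CC S x - x) \<bullet> (y - y') = 0" if y: "y \<in> A \<inter> B" "y' \<in> A \<inter> B" for y y'
    proof -
      have t: "(t - x) \<bullet> (y - y') = 0" if "t \<in> X" for t
        using that A.reflector_orth[of y y' x] B.reflector_orth[of y y' x]
          B.reflector_orth[of y y' ?a] y
        by (auto simp: X inner_diff_left)
      have "(y - y') \<bullet> (CC S x - x) = 0"
      proof (rule inner_affine_hull_const[OF _ CC(1)])
        show "x \<in> affine hull X" by (rule hull_inc) (simp add: X)
        show "(y - y') \<bullet> (s - s') = 0" if "s \<in> X" "s' \<in> X" for s s'
          using t[OF that(1)] t[OF that(2)] by (simp add: inner_diff_left inner_diff_right inner_commute)
      qed
      then show ?thesis by (simp add: inner_commute)
    qed
    then have 1: "proj (A \<inter> B) (CC S x) = proj (A \<inter> B) x" unfolding M.proj_eq_iff by blast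
    have mid: "(1/2) *\<^sub>R (s + t) \<in> affine hull X" if "s \<in> affine hull X" "t \<in> affine hull X" for s t
      using mem_affine[OF affine_affine_hull that, of "1/2" "1/2"] by (simp add: scaleR_add_right)
    \<comment> \<open>\<open>P\<^sub>B P\<^sub>A x\<close> is the mean of the four points, and the circumcenter is the point closest to \<open>w\<close>.\<close>
    have "proj B (proj A x) = (1/2) *\<^sub>R (proj B x + proj B ?a)"
      by (simp only: A.proj_eq_midpoint_reflector B.proj_midpoint)
    also have "\<dots> = (1/2) *\<^sub>R ((1/2) *\<^sub>R (x + ?b) + (1/2) *\<^sub>R (?a + ?c))"
      by (simp only: B.proj_eq_midpoint_reflector)
    also have "\<dots> \<in> affine hull X" by (intro mid hull_inc) (auto simp: X)
    finally have y: "proj B (proj A x) \<in> affine hull X" .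
    have "(norm (w - proj B (proj A x)))\<^sup>2
        = (norm (w - CC S x))\<^sup>2 + (norm (CC S x - proj B (proj A x)))\<^sup>2"
      using pythagoras[of "w - CC S x" "CC S x - proj B (proj A x)"] CC(2)[OF y]
      by (simp add: inner_diff_right)
    then have "norm (w - CC S x) \<le> norm (w - proj B (proj A x))"
      by (intro power2_le_imp_le[OF _ norm_ge_zero]) simp
    also have "\<dots> \<le> \<gamma> * norm (x - w)"
      using bam unfolding bam_def w_def by (simp add: norm_minus_commute)
    finally show ?thesis using 1 by (simp add: w_def norm_minus_commute)
  qed
  then show ?thesis using bam unfolding bam_def by blast
qed

text \<open>Projections have constant 0, so \<open>bam_fold\<close> makes the alternating projection
  \<open>proj B \<circ> proj A\<close> a best approximation mapping, and the circumcenter inherits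
  its constant. The booleans index the pair, with \<open>True\<close> for \<open>A\<close>, which is
  applied first.\<close>

lemma bam_CC_if_closed_sum_par:
  fixes A B :: "'a::{real_inner, complete_space} set"
  assumes A: "closed_affine A" and B: "closed_affine B" and ne: "A \<inter> B \<noteq> {}"
    and clo: "closed (par A + par B)"
    and S: "S = {id, reflector A, reflector B, reflector B \<circ> reflector A}"
  shows "\<exists>\<gamma>. bam \<gamma> (A \<inter> B) (CC S)"
proof -
  define U where "U = (\<lambda>b. if b then A else B)"
  have U: "U True = A" "U False = B" by (simp_all add: U_def)
  have "\<exists>\<gamma>. bam \<gamma> (\<Inter>b\<in>set [True, False]. U b) (fold (\<lambda>b F. proj (U b) \<circ> F) [True, False] id)"
  proof (rule bam_fold)
    show CA: "closed_affine (U b)" for b using A B by (simp add: U_def)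
    show "\<exists>\<gamma>. bam \<gamma> (U b) (proj (U b))" for b using closed_affine.bam_proj[OF CA] by blast
    show "linearly_regular (set [True, False]) U"
      using linearly_regular_pair_if_closed_sum_par[of True False U] A B ne clo by (simp add: U)
  qed (use ne in \<open>simp_all add: U\<close>)
  then obtain \<gamma> where "bam \<gamma> (A \<inter> B) (proj B \<circ> proj A)" by (auto simp: U)
  then show ?thesis using bam_CC[OF A B ne _ S] by blast
qed

section \<open>Grouping the subspaces into consecutive pairs and the conclusion\<close>

lemma sum_consecutive_pairs:
  "(\<Sum>j=1..2*m. f j) = (\<Sum>i=1..m. f (2*i - 1) + f (2*i))" for f :: "nat \<Rightarrow> 'a::comm_monoid_add"
  by (induction m) (simp_all add: add.assoc)

lemma Inter_consecutive_pairs: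
  "(\<Inter>j\<in>{1..2*m}. U j) = (\<Inter>i\<in>{1..m}. U (2*i - 1) \<inter> U (2*i))" for U :: "nat \<Rightarrow> 'a set"
proof -
  have "\<exists>i\<in>{1..m}. j = 2*i - 1 \<or> j = 2*i" if "j \<in> {1..2*m}" for j
  \<comment> \<open>The index of the pair containing \<open>j\<close> is \<open>j / 2\<close>
    rounded up.\<close>
  proof (rule bexI[of _ "(j + 1) div 2"])
    show "j = 2 * ((j + 1) div 2) - 1 \<or> j = 2 * ((j + 1) div 2)" by presburger
  qed (use that in auto)
  moreover have "2*i - 1 \<in> {1..2*m}" "2*i \<in> {1..2*m}" if "i \<in> {1..m}" for i using that by auto
  ultimately show ?thesis by (intro equalityI subsetI INT_I) (blast, fast)
qed

text \<open>Each pair's intersection is contained in both members, so its distance dominates theirs;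
  two members per pair give the factor 2.\<close>

lemma linearly_regular_consecutive_pairs:
  fixes U :: "nat \<Rightarrow> 'a::{real_inner, complete_space} set"
  assumes U: "\<And>j. j \<in> {1..2*m} \<Longrightarrow> closed_affine (U j)"
    and ne: "(\<Inter>j\<in>{1..2*m}. U j) \<noteq> {}" and reg: "linearly_regular {1..2*m} U"
  shows "linearly_regular {1..m} (\<lambda>i. U (2*i - 1) \<inter> U (2*i))"
proof -
  let ?V = "\<lambda>i. U (2*i - 1) \<inter> U (2*i)"
  obtain \<kappa> where \<kappa>: "0 \<le> \<kappa>" "\<And>x. norm (x - proj (\<Inter>j\<in>{1..2*m}. U j) x)
      \<le> \<kappa> * (\<Sum>j=1..2*m. norm (x - proj (U j) x))"
    using reg unfolding linearly_regular_def by blast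
  have "norm (x - proj (\<Inter>i\<in>{1..m}. ?V i) x) \<le> (2 * \<kappa>) * (\<Sum>i=1..m. norm (x - proj (?V i) x))" for x
  proof -
    have "(\<Sum>j=1..2*m. norm (x - proj (U j) x)) \<le> (\<Sum>i=1..m. 2 * norm (x - proj (?V i) x))"
      unfolding sum_consecutive_pairs
    proof (rule sum_mono)
      fix i assume i: "i \<in> {1..m}"
      then have mem: "2*i - 1 \<in> {1..2*m}" "2*i \<in> {1..2*m}" by auto
      have "?V i \<noteq> {}" using ne mem by blast
      then interpret V: closed_affine "?V i" using U mem by (intro closed_affine_Int) auto
      have "norm (x - proj (U j) x) \<le> norm (x - proj (?V i) x)" if "j \<in> {2*i - 1, 2*i}" for j
      proof (rule closed_affine.norm_proj_le)
        show "closed_affine (U j)" using U mem that by auto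
        show "proj (?V i) x \<in> U j" using V.proj_in[of x] that by auto
      qed
      from this[of "2*i - 1"] this[of "2*i"]
      show "norm (x - proj (U (2*i - 1)) x) + norm (x - proj (U (2*i)) x)
          \<le> 2 * norm (x - proj (?V i) x)" by simp
    qed
    from mult_left_mono[OF this \<kappa>(1)] \<kappa>(2)[of x] show ?thesis
      unfolding Inter_consecutive_pairs sum_distrib_left[symmetric] by (simp add: mult_ac)
  qed
  then show ?thesis unfolding linearly_regular_def using \<kappa>(1) by (intro exI[of _ "2 * \<kappa>"]) simp
qed

theorem theorem6p28:
  fixes U :: "nat \<Rightarrow> 'a::{real_inner, complete_space} set"
    and S :: "nat \<Rightarrow> ('a \<Rightarrow> 'a) set"
    and G :: "'a \<Rightarrow> 'a"
    and m :: nat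
  assumes "m \<ge> 1"
    and "\<And>j. j \<in> {1..2*m} \<Longrightarrow> U j \<noteq> {} \<and> affine (U j) \<and> closed (U j)"
    and "(\<Inter>j\<in>{1..2*m}. U j) \<noteq> {}"
    and "\<And>i. i \<in> {1..m} \<Longrightarrow> closed (par (U (2*i - 1)) + par (U (2*i)))"
    and "\<And>i. i \<in> {1..m} \<Longrightarrow>
           S i = {id, reflector (U (2*i - 1)), reflector (U (2*i)),
                  reflector (U (2*i)) \<circ> reflector (U (2*i - 1))}"
    and "((\<forall>i\<in>{1..m}. closed (\<Sum>j=1..2*i. orthogonal_comp (par (U j)))) \<and>
          G = fold (\<lambda>i F. CC (S i) \<circ> F) [1..<Suc m] id)
       \<or> (closed (\<Sum>j=1..2*m. orthogonal_comp (par (U j))) \<and>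
          (\<exists>\<omega> :: nat \<Rightarrow> real. (\<forall>i\<in>{1..m}. 0 < \<omega> i \<and> \<omega> i \<le> 1) \<and> (\<Sum>i=1..m. \<omega> i) = 1 \<and>
             G = (\<lambda>x. \<Sum>i=1..m. \<omega> i *\<^sub>R CC (S i) x)))"
  shows "Fix G = (\<Inter>j\<in>{1..2*m}. U j) \<and>
    is_BAM G \<and>
    (\<exists>\<gamma>::real. 0 \<le> \<gamma> \<and> \<gamma> < 1 \<and>
       (\<forall>x. \<forall>k::nat. norm ((G ^^ k) x - proj (\<Inter>j\<in>{1..2*m}. U j) x)
                      \<le> \<gamma> ^ k * norm (x - proj (\<Inter>j\<in>{1..2*m}. U j) x)))"
proof -
  let ?V = "\<lambda>i. U (2*i - 1) \<inter> U (2*i)"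
  have U: "closed_affine (U j)" if "j \<in> {1..2*m}" for j
    using assms(2)[OF that] by unfold_locales auto
  interpret C: closed_affine "\<Inter>j\<in>{1..2*m}. U j"
    using U assms(3) by (rule closed_affine_Inter)
  have mem: "2*i - 1 \<in> {1..2*m}" "2*i \<in> {1..2*m}" if "i \<in> {1..m}" for i using that by auto
  have neV: "?V i \<noteq> {}" if "i \<in> {1..m}" for i using assms(3) mem[OF that] by blast
  have V: "closed_affine (?V i)" if "i \<in> {1..m}" for i
    using U mem[OF that] neV[OF that] by (intro closed_affine_Int) auto
  have bam: "\<exists>\<gamma>. bam \<gamma> (?V i) (CC (S i))" if "i \<in> {1..m}" for i
    using U mem[OF that] neV[OF that] assms(4,5)[OF that] by (intro bam_CC_if_closed_sum_par) auto
  have ne: "(\<Inter>i\<in>{1..m}. ?V i) \<noteq> {}" using assms(3) unfolding Inter_consecutive_pairs .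
  \<comment> \<open>Case (i) supplies this at \<open>i = m\<close>, which lies in the index range
    since \<open>1 \<le> m\<close>; case (ii) assumes it directly.\<close>
  have "closed (\<Sum>j=1..2*m. orthogonal_comp (par (U j)))" using assms(1,6) by auto
  then have "linearly_regular {1..2*m} U"
    using U assms(3) by (intro linearly_regular_if_closed_sum_orthogonal_comp) auto
  then have reg: "linearly_regular {1..m} ?V"
    using U assms(3) by (intro linearly_regular_consecutive_pairs)
  have set: "set [1..<Suc m] = {1..m}" by auto
  have "\<exists>\<gamma>. bam \<gamma> (\<Inter>i\<in>{1..m}. ?V i) G"
    using assms(6)
  proof (elim disjE conjE exE)
    assume "G = fold (\<lambda>i F. CC (S i) \<circ> F) [1..<Suc m] id"
    then show ?thesis
      using bam_fold[of "[1..<Suc m]" ?V "\<lambda>i. CC (S i)"] V bam ne reg assms(1)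
      unfolding set by simp
  next
    fix \<omega> :: "nat \<Rightarrow> real"
    assume \<omega>: "\<forall>i\<in>{1..m}. 0 < \<omega> i \<and> \<omega> i \<le> 1" "(\<Sum>i=1..m. \<omega> i) = 1"
      and G: "G = (\<lambda>x. \<Sum>i=1..m. \<omega> i *\<^sub>R CC (S i) x)"
    show ?thesis
      unfolding G using V bam ne reg \<omega> by (intro bam_convex_combination) auto
  qed
  then obtain \<gamma> where \<gamma>: "bam \<gamma> (\<Inter>j\<in>{1..2*m}. U j) G" unfolding Inter_consecutive_pairs by blast
  show ?thesis
  proof (intro conjI exI[of _ \<gamma>] allI)
    show "is_BAM G" unfolding is_BAM_def using C.bam_imp_is_gamma_BAM[OF \<gamma>] by blast
    show "0 \<le> \<gamma>" "\<gamma> < 1" using \<gamma> by (simp_all add: bam_def)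
  qed (use C.bam_Fix[OF \<gamma>] C.bam_funpow[OF \<gamma>] in auto)
qed

end
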